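(* In the setting described in the context, let $\mathbf{L}_t$ be the subspace basis produced by the O-LSD iteration at time $t$. Then $g_t(\mathbf{L}_t)-f(\mathbf{L}_t)$ converges to $0$ almost surely as $t\to\infty$.
   Context: Fix integers $p,r\ge 1$ and constants $\lambda_1,\lambda_2>0$. Let $\mathcal{G}$ be a finite collection of subsets of $\{1,\dots,p\}$. For $\mathbf{s}\in\mathbb{R}^p$ and $g\in\mathcal{G}$, let $\mathbf{s}_{|g}$ be the vector equal to $\mathbf{s}$ on indices in $g$ and zero elsewhere, and $\|\mathbf{s}\|_{\ell_1/\ell_\infty}=\sum_{g\in\mathcal{G}}\|\mathbf{s}_{|g}\|_\infty$. Define $\hat\ell(\mathbf{d},\mathbf{L},\mathbf{r},\mathbf{s})=\tfrac12\|\mathbf{d}-\mathbf{L}\mathbf{r}-\mathbf{s}\|_2^2+\tfrac{\lambda_1}{2}\|\mathbf{r}\|_2^2+\lambda_2\|\mathbf{s}\|_{\ell_1/\ell_\infty}$ and $\ell(\mathbf{d},\mathbf{L})=\min_{\mathbf{r},\mathbf{s}}\hat\ell(\mathbf{d},\mathbf{L},\mathbf{r},\mathbf{s})$. Data assumption: $\mathbf{d}_1,\mathbf{d}_2,\dots\in\mathbb{R}^p$ are independent random vectors with a common distribution (that of a random vector $\mathbf{d}$), uniformly bounded (there is $M$ with $\|\mathbf{d}_t\|_2\le M$ for all $t$). O-LSD iteration: arbitrary $\mathbf{L}_0\in\mathbb{R}^{p\times r}$, $\mathbf{A}_0=\mathbf{0}$, $\mathbf{B}_0=\mathbf{0}$.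 For $t\ge1$: $(\mathbf{r}_t,\mathbf{s}_t)$ is a minimizer of $\hat\ell(\mathbf{d}_t,\mathbf{L}_{t-1},\cdot,\cdot)$; $\mathbf{A}_t=\mathbf{A}_{t-1}+\mathbf{r}_t\mathbf{r}_t^T$, $\mathbf{B}_t=\mathbf{B}_{t-1}+(\mathbf{d}_t-\mathbf{s}_t)\mathbf{r}_t^T$; $\mathbf{L}_t$ is the minimizer of the surrogate function $g_t(\mathbf{L})=\frac1t\sum_{i=1}^t\hat\ell(\mathbf{d}_i,\mathbf{L},\mathbf{r}_i,\mathbf{s}_i)+\frac{\lambda_1}{2t}\|\mathbf{L}\|_F^2$, i.e. $\mathbf{L}_t=\mathbf{B}_t(\mathbf{A}_t+\lambda_1\mathbf{I})^{-1}$. Expected cost function: $f(\mathbf{L})=\mathbb{E}_{\mathbf{d}}[\ell(\mathbf{d},\mathbf{L})]$. *)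

theory Defs
  imports "HOL-Probability.Probability"
begin

text \<open>Vectors in R^p are real^'p, vectors in R^r are real^'r, and a p x r matrix is
  real^'r^'p (rows indexed by 'p). The Euclidean norm of a vector and the Frobenius
  norm of a matrix are both the library norm.\<close>

definition restr :: "'p set \<Rightarrow> real^'p \<Rightarrow> real^'p" where
  "restr g s = (\<chi> i. if i \<in> g then s $ i else 0)"

definition group_norm :: "'p set set \<Rightarrow> real^'p \<Rightarrow> real" where
  "group_norm G s = (\<Sum>g\<in>G. infnorm (restr g s))"

definition lhat :: "'p set set \<Rightarrow> real \<Rightarrow> real \<Rightarrow> real^'p \<Rightarrow> real^'r^'p \<Rightarrow> real^'r \<Rightarrow> real^'p \<Rightarrow> real" where
  "lhat G l1 l2 d L r s =
     (1/2) * (norm (d - L *v r - s))\<^sup>2 + (l1/2) * (norm r)\<^sup>2 + l2 * group_norm G s"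

definition ell :: "'p set set \<Rightarrow> real \<Rightarrow> real \<Rightarrow> real^'p \<Rightarrow> real^'r^'p \<Rightarrow> real" where
  "ell G l1 l2 d L = (INF rs. lhat G l1 l2 d L (fst rs) (snd rs))"

definition exp_cost :: "'p set set \<Rightarrow> real \<Rightarrow> real \<Rightarrow> (real^'p) measure \<Rightarrow> real^'r^'p \<Rightarrow> real" where
  "exp_cost G l1 l2 D L = (\<integral>x. ell G l1 l2 x L \<partial>D)"

definition outer :: "real^'a \<Rightarrow> real^'b \<Rightarrow> real^'b^'a" where
  "outer u v = (\<chi> i j. u $ i * v $ j)"

definition surrogate :: "'p set set \<Rightarrow> real \<Rightarrow> real \<Rightarrow> (nat \<Rightarrow> real^'p) \<Rightarrow> (nat \<Rightarrow> real^'r)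
    \<Rightarrow> (nat \<Rightarrow> real^'p) \<Rightarrow> nat \<Rightarrow> real^'r^'p \<Rightarrow> real" where
  "surrogate G l1 l2 d r s t L =
     (1 / real t) * (\<Sum>i=1..t. lhat G l1 l2 (d i) L (r i) (s i)) + l1 / (2 * real t) * (norm L)\<^sup>2"

end

theory Submission
  imports Defs
begin

text \<open>
  The iterates \<open>L\<^sub>t\<close> may be unbounded, and the surrogates are not uniformly strongly convex, so the
  proof uses neither compactness nor a small step size. Let \<open>e\<close> be the optimal residual
  \<open>d - L r - s\<close>; optimality gives \<open>r = L\<^sup>T e / \<lambda>\<^sub>1\<close>, and \<open>e\<close> is the gradient of the cost in \<open>d\<close>. With
  \<open>K\<^sub>t = (A\<^sub>t + \<lambda>\<^sub>1 I)\<^sup>-\<^sup>1\<close> and \<open>m\<^sub>t = K\<^sub>t r\<^sub>t\<^sub>+\<^sub>1\<close>, the Sherman-Morrison formula shows that the trace of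
  \<open>K\<^sub>t\<close> decreases by a multiple of \<open>|m\<^sub>t|\<^sup>2\<close>, hence \<open>\<Sum>\<^sub>t |m\<^sub>t|\<^sup>2\<close> is bounded on every trajectory, and
  that \<open>L\<^sub>t\<^sub>+\<^sub>1 - L\<^sub>t\<close> is a positive multiple, tending to 1, of the rank-one matrix \<open>e m\<^sub>t\<^sup>T\<close>. This is
  stochastic gradient descent on the expected cost \<open>f\<close> with preconditioner \<open>K\<^sub>t\<close>: up to martingale
  differences with summable variances and errors \<open>O(|m\<^sub>t|\<^sup>2)\<close>, the sequence \<open>f(L\<^sub>t)\<close> is nonincreasing,
  so it converges almost surely.

  On the other hand, minimality of \<open>L\<^sub>t\<close> and of \<open>L\<^sub>t\<^sub>+\<^sub>1\<close> shows that the increment of \<open>t g\<^sub>t(L\<^sub>t)\<close> differs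
  from the cost of sample \<open>t + 1\<close> at \<open>L\<^sub>t\<close> by \<open>O(|m\<^sub>t|)\<close>. Averaging, and using the strong law for the bounded
  martingale differences \<open>cost(d\<^sub>t\<^sub>+\<^sub>1, L\<^sub>t) - f(L\<^sub>t)\<close>, gives \<open>g\<^sub>t(L\<^sub>t) \<rightarrow> lim f(L\<^sub>t)\<close>.
\<close>

section \<open>Convergence of sums of martingale differences\<close>

lemma Cesaro_tendsto:
  fixes a :: "nat \<Rightarrow> real"
  assumes "a \<longlonglongrightarrow> l"
  shows "(\<lambda>n. (\<Sum>i<n. a i) / real n) \<longlonglongrightarrow> l"
proof (rule LIMSEQ_I)
  fix e :: real assume e: "e > 0"
  obtain N where N: "\<And>n. n \<ge> N \<Longrightarrow> \<bar>a n - l\<bar> < e / 2"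
    using LIMSEQ_D[OF assms, of "e / 2"] e by (auto simp: real_norm_def)
  define C where "C = (\<Sum>i<N. \<bar>a i - l\<bar>)"
  obtain K :: nat where K: "real K > 2 * C / e" using reals_Archimedean2 by blast
  show "\<exists>n0. \<forall>n\<ge>n0. norm ((\<Sum>i<n. a i) / real n - l) < e"
  proof (intro exI allI impI)
    fix n assume n: "n \<ge> max (Suc N) (Suc K)"
    have n0: "real n > 0" using n by auto
    have "(\<Sum>i<n. a i) / real n - l = (\<Sum>i<n. a i - l) / real n"
      using n0 by (simp add: sum_subtractf field_simps)
    then have "\<bar>(\<Sum>i<n. a i) / real n - l\<bar> = \<bar>\<Sum>i<n. a i - l\<bar> / real n"
      using n0 by simp
    also have "\<bar>\<Sum>i<n. a i - l\<bar> \<le> (\<Sum>i<n. \<bar>a i - l\<bar>)" by (rule sum_abs)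
    also have "(\<Sum>i<n. \<bar>a i - l\<bar>) = C + (\<Sum>i=N..<n. \<bar>a i - l\<bar>)"
      using sum.atLeastLessThan_concat[of 0 N n "\<lambda>i. \<bar>a i - l\<bar>"] n
      by (simp add: C_def lessThan_atLeast0)
    also have "(\<Sum>i=N..<n. \<bar>a i - l\<bar>) \<le> (\<Sum>i=N..<n. e / 2)"
      using N by (intro sum_mono less_imp_le) auto
    also have "\<dots> = real (n - N) * (e / 2)" by simp
    also have "\<dots> \<le> real n * (e / 2)" using e by (intro mult_right_mono) auto
    finally have "\<bar>(\<Sum>i<n. a i) / real n - l\<bar> \<le> (C + real n * (e / 2)) / real n"
      using n0 by (simp add: divide_right_mono)
    also have "\<dots> = C / real n + e / 2" using n0 by (simp add: field_simps)
    also have "C / real n < e / 2"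
    proof -
      have "2 * C / e < real n" using K n by linarith
      then show ?thesis using e n0 by (simp add: field_simps)
    qed
    finally show "norm ((\<Sum>i<n. a i) / real n - l) < e" by simp
  qed
qed

text \<open>Kronecker's lemma for the weights \<open>Suc n\<close>. Summation by parts turns the
  average of \<open>x\<close> into \<open>S n\<close> minus the Cesaro mean of \<open>S\<close>, and
  both have the same limit.\<close>

lemma Kronecker_tendsto:
  fixes x :: "nat \<Rightarrow> real"
  assumes "summable (\<lambda>n. x n / real (Suc n))"
  shows "(\<lambda>n. (\<Sum>i<n. x i) / real n) \<longlonglongrightarrow> 0"
proof -
  define S where "S n = (\<Sum>i<n. x i / real (Suc i))" for n
  have S: "S \<longlonglongrightarrow> suminf (\<lambda>n. x n / real (Suc n))"
    unfolding S_def by (rule summable_LIMSEQ[OF assms])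
  have "(\<Sum>i<n. x i) = real n * S n - (\<Sum>i<n. S i)" for n
  proof (induction n)
    case (Suc n)
    have "S (Suc n) = S n + x n / real (Suc n)" by (simp add: S_def)
    then have "real (Suc n) * S (Suc n) = real (Suc n) * S n + x n"
      by (simp add: field_simps)
    then show ?case using Suc by (simp add: algebra_simps)
  qed simp
  then have *: "(\<Sum>i<n. x i) / real n = S n - (\<Sum>i<n. S i) / real n" if "n > 0" for n
    using that by (simp add: field_simps)
  have "(\<lambda>n. S n - (\<Sum>i<n. S i) / real n) \<longlonglongrightarrow> 0"
    using tendsto_diff[OF S Cesaro_tendsto[OF S]] by simp
  moreover have "\<forall>\<^sub>F n in sequentially. S n - (\<Sum>i<n. S i) / real n = (\<Sum>i<n. x i) / real n"
    using eventually_gt_at_top[of 0] by eventually_elim (simp add: *)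
  ultimately show ?thesis by (rule Lim_transform_eventually)
qed

text \<open>Instead of a vanishing conditional expectation, \<open>orth\<close> asks for
  orthogonality to every bounded \<open>F n\<close>-measurable function. The bounds
  \<open>c n\<close> may vary with \<open>n\<close>; they serve integrability, while sizes are
  measured by second moments.\<close>

locale martingale_differences = prob_space M for M :: "'a measure" +
  fixes F :: "nat \<Rightarrow> 'a measure" and X :: "nat \<Rightarrow> 'a \<Rightarrow> real" and c :: "nat \<Rightarrow> real"
  assumes sub: "\<And>n. subalgebra M (F n)"
    and mono: "\<And>n. subalgebra (F (Suc n)) (F n)"
    and X: "\<And>n. X n \<in> borel_measurable (F (Suc n))"
    and bd: "\<And>n \<omega>. \<omega> \<in> space M \<Longrightarrow> \<bar>X n \<omega>\<bar> \<le> c n"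
    and orth: "\<And>n Z B. Z \<in> borel_measurable (F n) \<Longrightarrow> (\<And>\<omega>. \<omega> \<in> space M \<Longrightarrow> \<bar>Z \<omega>\<bar> \<le> B) \<Longrightarrow>
      expectation (\<lambda>\<omega>. X n \<omega> * Z \<omega>) = 0"
begin

text \<open>The increments are stopped at the first exit of the partial sums from an interval of
  radius \<open>\<epsilon>\<close>; by orthogonality, Chebyshev's inequality for the stopped sum becomes
  Kolmogorov's maximal inequality.\<close>

lemma maximal_inequality:
  assumes eps: "\<epsilon> > 0"
  shows "prob {\<omega> \<in> space M. \<exists>j\<le>n. \<epsilon> \<le> \<bar>\<Sum>i<j. X (N + i) \<omega>\<bar>}
    \<le> (\<Sum>i<n. expectation (\<lambda>\<omega>. (X (N + i) \<omega>)\<^sup>2)) / \<epsilon>\<^sup>2"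
proof -
  define S where "S j \<omega> = (\<Sum>i<j. X (N + i) \<omega>)" for j \<omega>
  have up: "f \<in> borel_measurable (F m)" if "f \<in> borel_measurable (F k)" "k \<le> m"
    for f :: "'a \<Rightarrow> real" and k m
    using that(2,1) by (induction rule: dec_induct) (auto intro: measurable_from_subalg[OF mono])
  have toM: "f \<in> borel_measurable M" if "f \<in> borel_measurable (F k)" for f :: "'a \<Rightarrow> real" and k
    using measurable_from_subalg[OF sub that] .
  have S: "S j \<in> borel_measurable (F (N + n))" if "j \<le> n" for j n
    unfolding S_def using that
    by (intro borel_measurable_sum) (auto intro: up[OF X])
  \<comment> \<open>\<open>S i\<close> contains only the increments before \<open>X (N + i)\<close>,
    so this indicator is \<open>F (N + i)\<close>-measurable and may multiply
    \<open>X (N + i)\<close> without destroying orthogonality.\<close>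
  define ind where "ind i \<omega> = (if \<forall>j\<in>{..i}. \<bar>S j \<omega>\<bar> < \<epsilon> then 1 else 0 :: real)" for i \<omega>
  have ind: "ind i \<in> borel_measurable (F (N + i))" for i
  proof -
    have [measurable]: "S j \<in> borel_measurable (F (N + i))" if "j \<in> {..i}" for j
      using S[of j i] that by simp
    show ?thesis unfolding ind_def by measurable
  qed
  define Y where "Y i \<omega> = X (N + i) \<omega> * ind i \<omega>" for i \<omega>
  define T where "T n \<omega> = (\<Sum>i<n. Y i \<omega>)" for n \<omega>
  have Y: "Y i \<in> borel_measurable (F (N + Suc i))" for i
    unfolding Y_def using X[of "N + i"] up[OF ind[of i], of "N + Suc i"] by simp
  have T: "T n \<in> borel_measurable (F (N + n))" for n
    unfolding T_def by (intro borel_measurable_sum) (auto intro: up[OF Y])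
  have Yb: "\<bar>Y i \<omega>\<bar> \<le> c (N + i)" if "\<omega> \<in> space M" for i \<omega>
    using bd[OF that, of "N + i"] by (auto simp: Y_def ind_def)
  have Tb: "\<bar>T n \<omega>\<bar> \<le> (\<Sum>i<n. c (N + i))" if "\<omega> \<in> space M" for n \<omega>
    unfolding T_def by (rule order_trans[OF sum_abs]) (rule sum_mono, rule Yb[OF that])
  have bdint: "integrable M f"
    if "f \<in> borel_measurable M" "\<And>\<omega>. \<omega> \<in> space M \<Longrightarrow> \<bar>f \<omega>\<bar> \<le> B" for f :: "'a \<Rightarrow> real" and B
    using that by (intro integrable_const_bound[where B = B]) (auto intro!: AE_I2)
  have sqint: "integrable M (\<lambda>\<omega>. (f \<omega>)\<^sup>2)"
    if "f \<in> borel_measurable M" "\<And>\<omega>. \<omega> \<in> space M \<Longrightarrow> \<bar>f \<omega>\<bar> \<le> B" for f :: "'a \<Rightarrow> real" and B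
  proof (rule bdint)
    show "\<bar>(f \<omega>)\<^sup>2\<bar> \<le> B\<^sup>2" if "\<omega> \<in> space M" for \<omega>
      using power_mono[OF \<open>\<And>\<omega>. \<omega> \<in> space M \<Longrightarrow> \<bar>f \<omega>\<bar> \<le> B\<close>[OF that], of 2] by simp
  qed (use that(1) in measurable)
  have intT2: "integrable M (\<lambda>\<omega>. (T n \<omega>)\<^sup>2)" for n
    by (rule sqint[OF toM[OF T] Tb])
  have intY2: "integrable M (\<lambda>\<omega>. (Y i \<omega>)\<^sup>2)" for i
    by (rule sqint[OF toM[OF Y] Yb])
  have intX2: "integrable M (\<lambda>\<omega>. (X i \<omega>)\<^sup>2)" for i
    by (rule sqint[OF toM[OF X] bd])
  have intTY: "integrable M (\<lambda>\<omega>. T n \<omega> * Y n \<omega>)" for n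
    using Tb[of _ n] Yb[of _ n] toM[OF T[of n]] toM[OF Y[of n]]
    by (intro bdint[of _ "(\<Sum>i<n. c (N + i)) * c (N + n)"])
       (auto simp: abs_mult intro!: mult_mono order_trans[OF abs_ge_zero Tb])
  have TY: "expectation (\<lambda>\<omega>. T n \<omega> * Y n \<omega>) = 0" for n
  proof -
    have "expectation (\<lambda>\<omega>. X (N + n) \<omega> * (T n \<omega> * ind n \<omega>)) = 0"
    proof (rule orth)
      show "(\<lambda>\<omega>. T n \<omega> * ind n \<omega>) \<in> borel_measurable (F (N + n))"
        using T[of n] ind[of n] by measurable
      show "\<bar>T n \<omega> * ind n \<omega>\<bar> \<le> (\<Sum>i<n. c (N + i))" if "\<omega> \<in> space M" for \<omega>
        using Tb[OF that, of n] by (auto simp: ind_def)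
    qed
    then show ?thesis by (simp add: Y_def mult_ac)
  qed
  have ET: "expectation (\<lambda>\<omega>. (T n \<omega>)\<^sup>2) \<le> (\<Sum>i<n. expectation (\<lambda>\<omega>. (X (N + i) \<omega>)\<^sup>2))" for n
  proof (induction n)
    case 0
    then show ?case by (simp add: T_def)
  next
    case (Suc n)
    have "(T (Suc n) \<omega>)\<^sup>2 = (T n \<omega>)\<^sup>2 + 2 * (T n \<omega> * Y n \<omega>) + (Y n \<omega>)\<^sup>2" for \<omega>
      by (simp add: T_def power2_eq_square algebra_simps)
    then have "expectation (\<lambda>\<omega>. (T (Suc n) \<omega>)\<^sup>2)
        = expectation (\<lambda>\<omega>. (T n \<omega>)\<^sup>2) + expectation (\<lambda>\<omega>. (Y n \<omega>)\<^sup>2)"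
      using intT2[of n] intTY[of n] intY2[of n] TY[of n] by simp
    also have "expectation (\<lambda>\<omega>. (Y n \<omega>)\<^sup>2) \<le> expectation (\<lambda>\<omega>. (X (N + n) \<omega>)\<^sup>2)"
      by (intro integral_mono intY2 intX2) (auto simp: Y_def ind_def)
    finally show ?case using Suc by simp
  qed
  \<comment> \<open>From the first exit index \<open>k\<close> on, all factors \<open>ind i\<close>
    vanish, so the stopped sum keeps the value \<open>S k\<close>: an exit at any time up to
    \<open>n\<close> is still visible at time \<open>n\<close>.\<close>
  have "{\<omega> \<in> space M. \<exists>j\<le>n. \<epsilon> \<le> \<bar>S j \<omega>\<bar>} \<subseteq> {\<omega> \<in> space M. \<epsilon>\<^sup>2 \<le> (T n \<omega>)\<^sup>2}"
  proof safe
    fix \<omega> j assume \<omega>: "\<omega> \<in> space M" and j: "j \<le> n" "\<epsilon> \<le> \<bar>S j \<omega>\<bar>"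
    obtain k where k: "\<epsilon> \<le> \<bar>S k \<omega>\<bar>" and lt: "\<And>i. i < k \<Longrightarrow> \<bar>S i \<omega>\<bar> < \<epsilon>"
      using exists_least_iff[of "\<lambda>j. \<epsilon> \<le> \<bar>S j \<omega>\<bar>"] j(2) by (metis not_le)
    then have "k \<le> j" using j(2) by (meson not_le)
    have "T n \<omega> = (\<Sum>i<k. X (N + i) \<omega>)"
      unfolding T_def
    proof (rule sum.mono_neutral_cong_right)
      show "\<forall>i\<in>{..<n} - {..<k}. Y i \<omega> = 0"
      proof
        fix i assume "i \<in> {..<n} - {..<k}"
        then have "\<not> (\<forall>j\<in>{..i}. \<bar>S j \<omega>\<bar> < \<epsilon>)"
          using k by (meson DiffD2 atMost_iff lessThan_iff not_less)
        then show "Y i \<omega> = 0" unfolding Y_def ind_def by (simp only: if_False mult_zero_right)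
      qed
      show "Y i \<omega> = X (N + i) \<omega>" if "i \<in> {..<k}" for i
        using that lt by (auto simp: Y_def ind_def)
    qed (use \<open>k \<le> j\<close> j in auto)
    then have "\<epsilon> \<le> \<bar>T n \<omega>\<bar>" using k by (simp add: S_def)
    then show "\<epsilon>\<^sup>2 \<le> (T n \<omega>)\<^sup>2" using eps by (simp add: abs_le_square_iff[symmetric])
  qed
  moreover have "{\<omega> \<in> space M. \<epsilon>\<^sup>2 \<le> (T n \<omega>)\<^sup>2} \<in> events"
    using toM[OF T[of n]] by measurable
  ultimately have "prob {\<omega> \<in> space M. \<exists>j\<le>n. \<epsilon> \<le> \<bar>S j \<omega>\<bar>} \<le> prob {\<omega> \<in> space M. \<epsilon>\<^sup>2 \<le> (T n \<omega>)\<^sup>2}"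
    by (rule finite_measure_mono)
  also have "\<dots> \<le> expectation (\<lambda>\<omega>. (T n \<omega>)\<^sup>2) / \<epsilon>\<^sup>2"
    using eps by (intro integral_Markov_inequality_measure[where A = "space M"] intT2) auto
  also have "\<dots> \<le> (\<Sum>i<n. expectation (\<lambda>\<omega>. (X (N + i) \<omega>)\<^sup>2)) / \<epsilon>\<^sup>2"
    using ET by (intro divide_right_mono) auto
  finally show ?thesis by (simp add: S_def)
qed

text \<open>The maximal inequality is applied to the blocks that start at \<open>N\<close>. Its
  bound involves only the tail of the variance series, so almost surely some block stays within any
  prescribed radius, which is the Cauchy criterion.\<close>

lemma AE_summable:
  assumes sq: "summable (\<lambda>n. expectation (\<lambda>\<omega>. (X n \<omega>)\<^sup>2))"
  shows "AE \<omega> in M. summable (\<lambda>n. X n \<omega>)"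
proof -
  define v where "v n = expectation (\<lambda>\<omega>. (X n \<omega>)\<^sup>2)" for n
  have [measurable]: "X n \<in> borel_measurable M" for n
    using measurable_from_subalg[OF sub X] .
  define S where "S N j \<omega> = (\<Sum>i<j. X (N + i) \<omega>)" for N j \<omega>
  have [measurable]: "S N j \<in> borel_measurable M" for N j
    unfolding S_def by measurable
  have v0: "v n \<ge> 0" for n by (simp add: v_def)
  define tail where "tail N = (\<Sum>i. v (i + N))" for N
  have sv: "summable (\<lambda>i. v (i + N))" for N
    using summable_ignore_initial_segment[OF sq, of N] by (simp add: v_def)
  have "tail = (\<lambda>N. suminf v - (\<Sum>i<N. v i))"
    unfolding tail_def using sq by (intro ext suminf_minus_initial_segment) (simp add: v_def)
  moreover have "(\<lambda>N. suminf v - (\<Sum>i<N. v i)) \<longlonglongrightarrow> suminf v - suminf v"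
    using sq by (intro tendsto_intros summable_LIMSEQ) (simp add: v_def)
  ultimately have tail: "tail \<longlonglongrightarrow> 0" by simp
  have small: "AE \<omega> in M. \<exists>N. \<forall>j. \<bar>S N j \<omega>\<bar> < \<epsilon>" if eps: "\<epsilon> > 0" for \<epsilon> :: real
  proof -
    define Bad where "Bad N n = {\<omega> \<in> space M. \<exists>j\<le>n. \<epsilon> \<le> \<bar>S N j \<omega>\<bar>}" for N n
    have [measurable]: "Bad N n \<in> events" for N n
      unfolding Bad_def by measurable
    have le: "prob (\<Union>n. Bad N n) \<le> tail N / \<epsilon>\<^sup>2" for N
    proof (rule LIMSEQ_le_const2)
      show "(\<lambda>n. prob (Bad N n)) \<longlonglongrightarrow> prob (\<Union>n. Bad N n)"
        by (intro finite_Lim_measure_incseq) (auto simp: incseq_def Bad_def intro: order_trans)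
      have "prob (Bad N n) \<le> tail N / \<epsilon>\<^sup>2" for n
      proof -
        have "prob (Bad N n) \<le> (\<Sum>i<n. v (N + i)) / \<epsilon>\<^sup>2"
          unfolding Bad_def S_def v_def by (rule maximal_inequality[OF eps])
        also have "(\<Sum>i<n. v (N + i)) \<le> tail N"
          unfolding tail_def add.commute[of N] by (intro sum_le_suminf sv) (auto simp: v0)
        finally show ?thesis by (simp add: divide_right_mono)
      qed
      then show "\<exists>N0. \<forall>n\<ge>N0. prob (Bad N n) \<le> tail N / \<epsilon>\<^sup>2" by blast
    qed
    \<comment> \<open>Outcomes for which every block exits lie in each single exit event, so their
      probability is below every term of a null sequence.\<close>
    have "prob (\<Inter>N. \<Union>n. Bad N n) \<le> tail N / \<epsilon>\<^sup>2" for N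
      by (rule order_trans[OF finite_measure_mono le[of N]]) auto
    moreover have "(\<lambda>N. tail N / \<epsilon>\<^sup>2) \<longlonglongrightarrow> 0 / \<epsilon>\<^sup>2"
      by (intro tendsto_intros tail) (use eps in auto)
    ultimately have "prob (\<Inter>N. \<Union>n. Bad N n) \<le> 0"
      by (intro LIMSEQ_le_const[where X = "\<lambda>N. tail N / \<epsilon>\<^sup>2"]) auto
    then have "(\<Inter>N. \<Union>n. Bad N n) \<in> null_sets M"
      by (auto simp: null_sets_def emeasure_eq_measure intro!: antisym)
    then show ?thesis
      by (rule AE_I') (auto simp: Bad_def not_less, blast)
  qed
  have "AE \<omega> in M. \<forall>k. \<exists>N. \<forall>j. \<bar>S N j \<omega>\<bar> < 1 / real (Suc k)"
    unfolding AE_all_countable by (intro allI small) simp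
  then show ?thesis
  proof (rule AE_mp, intro AE_I2 impI)
    fix \<omega> assume *: "\<forall>k. \<exists>N. \<forall>j. \<bar>S N j \<omega>\<bar> < 1 / real (Suc k)"
    have "Cauchy (\<lambda>n. \<Sum>i<n. X i \<omega>)"
    proof (rule metric_CauchyI)
      fix e :: real assume "e > 0"
      then obtain k where k: "1 / real (Suc k) < e / 2"
        using reals_Archimedean[of "e / 2"] by (auto simp: inverse_eq_divide)
      obtain N where N: "\<And>j. \<bar>S N j \<omega>\<bar> < 1 / real (Suc k)" using * by blast
      have near: "\<bar>(\<Sum>i<m. X i \<omega>) - (\<Sum>i<N. X i \<omega>)\<bar> < e / 2" if "m \<ge> N" for m
      proof -
        have "(\<Sum>i<N + j. X i \<omega>) = (\<Sum>i<N. X i \<omega>) + S N j \<omega>" for j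
          unfolding S_def by (induction j) simp_all
        from this[of "m - N"] show ?thesis using N[of "m - N"] k that by simp
      qed
      show "\<exists>M. \<forall>m\<ge>M. \<forall>n\<ge>M. dist (\<Sum>i<m. X i \<omega>) (\<Sum>i<n. X i \<omega>) < e"
      proof (intro exI[of _ N] allI impI)
        fix m n assume "m \<ge> N" "n \<ge> N"
        then show "dist (\<Sum>i<m. X i \<omega>) (\<Sum>i<n. X i \<omega>) < e"
          using near[of m] near[of n] by (simp add: dist_real_def abs_if split: if_splits)
      qed
    qed
    then show "summable (\<lambda>n. X n \<omega>)"
      by (simp add: summable_iff_convergent Cauchy_convergent_iff)
  qed
qed

end

section \<open>Independent samples and averaging over a fresh sample\<close>

locale iid_sequence = prob_space M for M :: "'w measure" +
  fixes d :: "nat \<Rightarrow> 'w \<Rightarrow> 'b::{second_countable_topology, t2_space}"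
  assumes rv: "\<And>t. t \<ge> 1 \<Longrightarrow> d t \<in> borel_measurable M"
    and indep: "indep_vars (\<lambda>_. borel) d {1..}"
    and ident: "\<And>t. t \<ge> 1 \<Longrightarrow> distr M borel (d t) = distr M borel (d 1)"
begin

definition law :: "'b measure" where
  "law = distr M borel (d 1)"

text \<open>The sigma-algebra generated by the first \<open>n\<close> samples, pulled back along the
  whole tuple so that independence of disjoint blocks of indices applies directly.\<close>

definition history :: "nat \<Rightarrow> 'w measure" where
  "history n = vimage_algebra (space M) (\<lambda>\<omega>. \<lambda>i\<in>{1..n}. d i \<omega>) (PiM {1..n} (\<lambda>_. borel))"

lemma sets_law [simp, measurable_cong]: "sets law = sets borel"
  by (simp add: law_def)

lemma space_history [simp]: "space (history n) = space M"
  by (simp add: history_def)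

lemma prob_space_law: "prob_space law"
  unfolding law_def by (intro prob_space_distr rv) simp

lemma law_eq: "law = distr M borel (d (Suc n))"
  using ident[of "Suc n"] by (simp add: law_def)

lemma data_in_history:
  assumes "1 \<le> i" "i \<le> n"
  shows "d i \<in> borel_measurable (history n)"
proof -
  have "(\<lambda>\<omega>. \<lambda>i\<in>{1..n}. d i \<omega>) \<in> measurable (history n) (PiM {1..n} (\<lambda>_. borel))"
    unfolding history_def by (intro measurable_vimage_algebra1) (auto simp: space_PiM)
  from measurable_compose[OF this measurable_component_singleton[of i]] assms
  show ?thesis by simp
qed

lemma subalgebra_history: "subalgebra M (history n)"
proof -
  have "sets (history n) \<subseteq> sets M"
    unfolding history_def by (intro sets_image_in_sets measurable_restrict rv) auto
  then show ?thesis by (simp add: subalgebra_def)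
qed

lemma subalgebra_history_Suc: "subalgebra (history (Suc n)) (history n)"
proof -
  have "sets (history n) \<subseteq> sets (history (Suc n))"
    unfolding history_def[of n]
    by (intro sets_image_in_sets measurable_restrict data_in_history) auto
  then show ?thesis by (simp add: subalgebra_def)
qed

lemma history_measurable_M: "f \<in> measurable (history n) N \<Longrightarrow> f \<in> measurable M N"
  by (rule measurable_from_subalg[OF subalgebra_history])

lemma history_measurable_Suc: "f \<in> measurable (history n) N \<Longrightarrow> f \<in> measurable (history (Suc n)) N"
  by (rule measurable_from_subalg[OF subalgebra_history_Suc])

text \<open>Independence of the index blocks \<open>{1..n}\<close> and \<open>{Suc n}\<close>; the
  new sample is read as a tuple with one entry.\<close>

lemma prob_history_Int:
  assumes A: "A \<in> sets (history n)" and B: "B \<in> sets borel"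
  shows "prob (A \<inter> (d (Suc n) -` B \<inter> space M)) = prob A * prob (d (Suc n) -` B \<inter> space M)"
proof -
  let ?W = "\<lambda>\<omega>. \<lambda>i\<in>{1..n}. d i \<omega>" and ?V = "\<lambda>\<omega>. \<lambda>i\<in>{Suc n}. d i \<omega>"
  have "indep_var (PiM {1..n} (\<lambda>_. borel)) ?W (PiM {Suc n} (\<lambda>_. borel)) ?V"
    by (rule indep_var_restrict[OF indep]) auto
  then have ind: "indep_set (sets (history n))
      (sigma_sets (space M) {?V -` C \<inter> space M | C. C \<in> sets (PiM {Suc n} (\<lambda>_. borel))})"
    unfolding indep_var_eq history_def sets_vimage_algebra by simp
  have "(\<lambda>x. x (Suc n)) -` B \<inter> space (PiM {Suc n} (\<lambda>_. borel)) \<in> sets (PiM {Suc n} (\<lambda>_. borel :: 'b measure))"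
    by (rule measurable_sets[where A = borel, OF measurable_component_singleton[of _ _ "\<lambda>_. borel"] B]) simp
  moreover have "d (Suc n) -` B \<inter> space M
      = ?V -` ((\<lambda>x. x (Suc n)) -` B \<inter> space (PiM {Suc n} (\<lambda>_. borel))) \<inter> space M"
    by (auto simp: space_PiM)
  ultimately have "d (Suc n) -` B \<inter> space M
      \<in> sigma_sets (space M) {?V -` C \<inter> space M | C. C \<in> sets (PiM {Suc n} (\<lambda>_. borel))}"
    by (intro sigma_sets.Basic) blast
  then show ?thesis using ind A unfolding indep_sets2_eq by blast
qed

lemma identity_measurable: "(\<lambda>\<omega>. \<omega>) \<in> measurable M (history n)"
  by (rule history_measurable_M[of _ n]) simp

text \<open>The first factor is the outcome itself, with events restricted to
  \<open>history n\<close>. Fubini then integrates out the next sample for any function that depends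
  on the past in a \<open>history n\<close>-measurable way; this takes the place of conditional
  expectations.\<close>

lemma distr_history:
  "distr M (history n) (\<lambda>\<omega>. \<omega>) \<Otimes>\<^sub>M law = distr M (history n \<Otimes>\<^sub>M borel) (\<lambda>\<omega>. (\<omega>, d (Suc n) \<omega>))"
proof (rule pair_measure_eqI)
  show "sigma_finite_measure (distr M (history n) (\<lambda>\<omega>. \<omega>))"
    by (intro prob_space_imp_sigma_finite prob_space_distr identity_measurable)
  show "sigma_finite_measure law"
    by (intro prob_space_imp_sigma_finite prob_space_law)
  have pair: "(\<lambda>\<omega>. (\<omega>, d (Suc n) \<omega>)) \<in> measurable M (history n \<Otimes>\<^sub>M borel)"
    by (intro measurable_Pair identity_measurable rv) simp
  fix A B assume "A \<in> sets (distr M (history n) (\<lambda>\<omega>. \<omega>))" "B \<in> sets law"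
  then have A: "A \<in> sets (history n)" and B: "B \<in> sets borel" by auto
  have "A \<subseteq> space M" using sets.sets_into_space[OF A] by simp
  then have 1: "(\<lambda>\<omega>. \<omega>) -` A \<inter> space M = A"
    and 2: "(\<lambda>\<omega>. (\<omega>, d (Suc n) \<omega>)) -` (A \<times> B) \<inter> space M = A \<inter> (d (Suc n) -` B \<inter> space M)"
    by auto
  show "emeasure (distr M (history n) (\<lambda>\<omega>. \<omega>)) A * emeasure law B
      = emeasure (distr M (history n \<Otimes>\<^sub>M borel) (\<lambda>\<omega>. (\<omega>, d (Suc n) \<omega>))) (A \<times> B)"
    unfolding law_eq[of n] emeasure_distr[OF identity_measurable A] emeasure_distr[OF rv[of "Suc n", simplified] B]
      emeasure_distr[OF pair pair_measureI[OF A B]] 1 2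
    using prob_history_Int[OF A B] by (simp add: emeasure_eq_measure ennreal_mult'')
next
  show "sets (distr M (history n) (\<lambda>\<omega>. \<omega>) \<Otimes>\<^sub>M law)
      = sets (distr M (history n \<Otimes>\<^sub>M borel) (\<lambda>\<omega>. (\<omega>, d (Suc n) \<omega>)))"
    unfolding sets_distr by (intro sets_pair_measure_cong sets_distr sets_law)
qed

end

text \<open>In \<open>h \<omega> y\<close> the outcome enters only through the past, and
  \<open>y\<close> stands for the next sample. The bound is asked at attained sample values, with
  two separate outcomes, so that it controls both \<open>current\<close> and the integral
  \<open>average\<close>.\<close>

locale fresh_sample = iid_sequence M d for M :: "'w measure"
  and d :: "nat \<Rightarrow> 'w \<Rightarrow> 'b::{second_countable_topology, t2_space}" +
  fixes n :: nat and h :: "'w \<Rightarrow> 'b \<Rightarrow> real" and c :: real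
  assumes h: "(\<lambda>(\<omega>, y). h \<omega> y) \<in> borel_measurable (history n \<Otimes>\<^sub>M borel)"
    and h_bound: "\<And>\<omega> \<omega>'. \<omega> \<in> space M \<Longrightarrow> \<omega>' \<in> space M \<Longrightarrow> \<bar>h \<omega> (d (Suc n) \<omega>')\<bar> \<le> c"
begin

abbreviation "current \<omega> \<equiv> h \<omega> (d (Suc n) \<omega>)"

definition "average \<omega> = (\<integral>y. h \<omega> y \<partial>law)"

definition "centred \<omega> = current \<omega> - average \<omega>"

lemma average_measurable: "average \<in> borel_measurable (history n)"
proof -
  interpret law: prob_space law by (rule prob_space_law)
  show ?thesis
    unfolding average_def
    by (rule law.borel_measurable_lebesgue_integral) (use h in measurable)
qed

lemma current_measurable: "current \<in> borel_measurable (history (Suc n))"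
proof -
  have "(\<lambda>\<omega>. (\<omega>, d (Suc n) \<omega>)) \<in> measurable (history (Suc n)) (history n \<Otimes>\<^sub>M borel)"
    by (intro measurable_Pair history_measurable_Suc data_in_history) auto
  from measurable_compose[OF this h] show ?thesis by simp
qed

lemma c_nonneg: "0 \<le> c"
  using not_empty h_bound by (meson abs_ge_zero equals0I order_trans)

lemma average_bound:
  assumes "\<omega> \<in> space M"
  shows "\<bar>average \<omega>\<bar> \<le> c"
proof -
  have hm: "h \<omega> \<in> borel_measurable borel"
    using measurable_compose[OF measurable_Pair1'[of \<omega> "history n" borel] h] assms by simp
  have "average \<omega> = expectation (\<lambda>\<omega>'. h \<omega> (d (Suc n) \<omega>'))"
    unfolding average_def law_eq[of n] by (intro integral_distr rv hm) simp
  also have "\<bar>\<dots>\<bar> \<le> expectation (\<lambda>\<omega>'. \<bar>h \<omega> (d (Suc n) \<omega>')\<bar>)" by (rule integral_abs_bound)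
  also have "\<dots> \<le> expectation (\<lambda>_. c)"
  proof (rule integral_mono)
    show "integrable M (\<lambda>\<omega>'. \<bar>h \<omega> (d (Suc n) \<omega>')\<bar>)"
      using measurable_compose[OF rv[of "Suc n"] hm] h_bound[OF assms]
      by (intro integrable_const_bound[where B = c] AE_I2) auto
  qed (use h_bound[OF assms] in auto)
  finally show ?thesis by (simp add: prob_space)
qed

lemma integrable_bounded:
  "f \<in> borel_measurable (history m) \<Longrightarrow> (\<And>\<omega>. \<omega> \<in> space M \<Longrightarrow> \<bar>f \<omega>\<bar> \<le> B) \<Longrightarrow> integrable M f"
  for f :: "'w \<Rightarrow> real"
  by (intro integrable_const_bound[where B = B] AE_I2 history_measurable_M) auto

text \<open>This says that \<open>average\<close> is a version of the conditional expectation of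
  \<open>current\<close> given \<open>history n\<close>. It follows from the product form of the
  joint law and Fubini.\<close>

lemma expectation_current_times:
  assumes Z: "Z \<in> borel_measurable (history n)"
    and B: "\<And>\<omega>. \<omega> \<in> space M \<Longrightarrow> \<bar>Z \<omega>\<bar> \<le> B"
  shows "integrable M (\<lambda>\<omega>. current \<omega> * Z \<omega>)"
    and "expectation (\<lambda>\<omega>. current \<omega> * Z \<omega>) = expectation (\<lambda>\<omega>. average \<omega> * Z \<omega>)"
proof -
  show int: "integrable M (\<lambda>\<omega>. current \<omega> * Z \<omega>)"
  proof (rule integrable_bounded)
    show "(\<lambda>\<omega>. current \<omega> * Z \<omega>) \<in> borel_measurable (history (Suc n))"
      using current_measurable history_measurable_Suc[OF Z] by measurable
    show "\<bar>current \<omega> * Z \<omega>\<bar> \<le> c * B" if "\<omega> \<in> space M" for \<omega>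
      unfolding abs_mult using h_bound[OF that that] B[OF that] c_nonneg by (intro mult_mono) auto
  qed
  define N where "N = distr M (history n) (\<lambda>\<omega>. \<omega>)"
  note id = identity_measurable[of n]
  interpret law: prob_space law by (rule prob_space_law)
  interpret N: prob_space N unfolding N_def by (rule prob_space_distr[OF id])
  interpret pair_sigma_finite N law ..
  have [measurable_cong]: "sets N = sets (history n)" by (simp add: N_def)
  have pair: "(\<lambda>\<omega>. (\<omega>, d (Suc n) \<omega>)) \<in> measurable M (history n \<Otimes>\<^sub>M borel)"
    by (intro measurable_Pair id rv) simp
  have hZ: "(\<lambda>(\<omega>, y). h \<omega> y * Z \<omega>) \<in> borel_measurable (history n \<Otimes>\<^sub>M borel)"
    using h measurable_compose[OF measurable_fst Z, of borel]
    unfolding case_prod_beta' by (rule borel_measurable_times)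
  have "integrable (N \<Otimes>\<^sub>M law) (\<lambda>(\<omega>, y). h \<omega> y * Z \<omega>)"
    unfolding N_def distr_history using int
    by (subst integrable_distr_eq[OF pair hZ]) simp
  then have "(\<integral>\<omega>. (\<integral>y. h \<omega> y * Z \<omega> \<partial>law) \<partial>N) = integral\<^sup>L (N \<Otimes>\<^sub>M law) (\<lambda>(\<omega>, y). h \<omega> y * Z \<omega>)"
    by (simp add: integral_fst'[of "\<lambda>(\<omega>, y). h \<omega> y * Z \<omega>", symmetric])
  also have "\<dots> = expectation (\<lambda>\<omega>. current \<omega> * Z \<omega>)"
    unfolding N_def distr_history by (subst integral_distr[OF pair hZ]) simp
  also have "(\<integral>\<omega>. (\<integral>y. h \<omega> y * Z \<omega> \<partial>law) \<partial>N) = (\<integral>\<omega>. average \<omega> * Z \<omega> \<partial>N)"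
    by (simp add: average_def)
  also have "\<dots> = expectation (\<lambda>\<omega>. average \<omega> * Z \<omega>)"
    unfolding N_def using average_measurable Z by (subst integral_distr[OF id]) auto
  finally show "expectation (\<lambda>\<omega>. current \<omega> * Z \<omega>) = expectation (\<lambda>\<omega>. average \<omega> * Z \<omega>)" by simp
qed

lemma centred_measurable: "centred \<in> borel_measurable (history (Suc n))"
  unfolding centred_def using current_measurable history_measurable_Suc[OF average_measurable]
  by measurable

lemma centred_bound: "\<omega> \<in> space M \<Longrightarrow> \<bar>centred \<omega>\<bar> \<le> 2 * c"
  using h_bound[of \<omega> \<omega>] average_bound[of \<omega>] by (simp add: centred_def)

lemma centred_orthogonal:
  assumes Z: "Z \<in> borel_measurable (history n)"
    and B: "\<And>\<omega>. \<omega> \<in> space M \<Longrightarrow> \<bar>Z \<omega>\<bar> \<le> B"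
  shows "expectation (\<lambda>\<omega>. centred \<omega> * Z \<omega>) = 0"
proof -
  have "integrable M (\<lambda>\<omega>. average \<omega> * Z \<omega>)"
  proof (rule integrable_bounded)
    show "(\<lambda>\<omega>. average \<omega> * Z \<omega>) \<in> borel_measurable (history n)"
      using average_measurable Z by measurable
    show "\<bar>average \<omega> * Z \<omega>\<bar> \<le> c * B" if "\<omega> \<in> space M" for \<omega>
      unfolding abs_mult using average_bound[OF that] B[OF that] c_nonneg by (intro mult_mono) auto
  qed
  then show ?thesis
    using expectation_current_times[OF Z B] by (simp add: centred_def left_diff_distrib)
qed

text \<open>By the previous identity the mixed moment equals the second moment of
  \<open>average\<close>, so centring subtracts that moment: \<open>average\<close> is an orthogonal
  projection.\<close>

lemma centred_second_moment:
  "expectation (\<lambda>\<omega>. (centred \<omega>)\<^sup>2) \<le> expectation (\<lambda>\<omega>. (current \<omega>)\<^sup>2)"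
proof -
  note meas = history_measurable_Suc[OF average_measurable] current_measurable
  have avg2: "integrable M (\<lambda>\<omega>. average \<omega> * average \<omega>)"
  proof (rule integrable_bounded)
    show "\<bar>average \<omega> * average \<omega>\<bar> \<le> c * c" if "\<omega> \<in> space M" for \<omega>
      unfolding abs_mult using average_bound[OF that] c_nonneg by (intro mult_mono) auto
  qed (use meas in measurable)
  have cur2: "integrable M (\<lambda>\<omega>. current \<omega> * current \<omega>)"
  proof (rule integrable_bounded)
    show "\<bar>current \<omega> * current \<omega>\<bar> \<le> c * c" if "\<omega> \<in> space M" for \<omega>
      unfolding abs_mult using h_bound[OF that that] c_nonneg by (intro mult_mono) auto
  qed (use meas in measurable)
  note mixed = expectation_current_times[OF average_measurable average_bound]
  have "expectation (\<lambda>\<omega>. (centred \<omega>)\<^sup>2)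
      = expectation (\<lambda>\<omega>. current \<omega> * current \<omega> - 2 * (current \<omega> * average \<omega>) + average \<omega> * average \<omega>)"
    by (simp add: centred_def power2_eq_square algebra_simps)
  also have "\<dots> = expectation (\<lambda>\<omega>. current \<omega> * current \<omega>) - expectation (\<lambda>\<omega>. average \<omega> * average \<omega>)"
    using avg2 cur2 mixed by simp
  also have "\<dots> \<le> expectation (\<lambda>\<omega>. current \<omega> * current \<omega>)"
    by simp
  finally show ?thesis by (simp add: power2_eq_square)
qed

end

text \<open>The form in which martingale convergence is applied: once to costs divided by
  \<open>Suc n\<close>, once to the first-order change of the expected cost.\<close>

lemma (in iid_sequence) AE_summable_centred:
  assumes fresh: "\<And>n. fresh_sample M d n (h n) (c n)"
    and sq: "summable (\<lambda>n. expectation (\<lambda>\<omega>. (h n \<omega> (d (Suc n) \<omega>))\<^sup>2))"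
  shows "AE \<omega> in M. summable (\<lambda>n. h n \<omega> (d (Suc n) \<omega>) - (\<integral>y. h n \<omega> y \<partial>law))"
proof -
  define X where "X n \<omega> = h n \<omega> (d (Suc n) \<omega>) - (\<integral>y. h n \<omega> y \<partial>law)" for n \<omega>
  have X: "fresh_sample.centred M d n (h n) = X n" for n
  proof -
    interpret fresh_sample M d n "h n" "c n" by (rule fresh)
    show ?thesis by (simp add: fun_eq_iff X_def centred_def average_def)
  qed
  interpret X: martingale_differences M history X "\<lambda>n. 2 * c n"
    by unfold_locales
      (fact subalgebra_history subalgebra_history_Suc
        fresh_sample.centred_measurable[OF fresh, unfolded X]
        fresh_sample.centred_bound[OF fresh, unfolded X]
        fresh_sample.centred_orthogonal[OF fresh, unfolded X])+
  have "summable (\<lambda>n. expectation (\<lambda>\<omega>. (X n \<omega>)\<^sup>2))"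
    using fresh_sample.centred_second_moment[OF fresh] unfolding X
    by (intro summable_comparison_test'[OF sq, of 0]) auto
  from X.AE_summable[OF this] show ?thesis by (simp add: X_def)
qed

section \<open>Matrices and rank-one updates\<close>

lemma continuous_on_matrix_vector_mult [continuous_intros]:
  fixes A :: "'a::topological_space \<Rightarrow> real^'n^'m"
  shows "continuous_on S A \<Longrightarrow> continuous_on S x \<Longrightarrow> continuous_on S (\<lambda>y. A y *v x y)"
  unfolding matrix_vector_mult_def by (intro continuous_intros)

lemma inner_matrix_vector: "x \<bullet> (A *v y) = (transpose A *v x) \<bullet> (y :: real^'n)"
  by (simp add: dot_lmul_matrix)

lemma outer_mult_vector: "outer a b *v x = (b \<bullet> x) *\<^sub>R a"
  by (simp add: outer_def matrix_vector_mult_def vec_eq_iff inner_vec_def sum_distrib_left mult_ac)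

lemma outer_mult_matrix: "outer a b ** (C :: real^'n^'m) = outer a (transpose C *v b)"
  by (simp add: outer_def matrix_matrix_mult_def matrix_vector_mult_def transpose_def vec_eq_iff
      sum_distrib_left mult_ac)

lemma matrix_mult_outer: "(C :: real^'n^'m) ** outer a b = outer (C *v a) b"
  by (simp add: outer_def matrix_matrix_mult_def matrix_vector_mult_def vec_eq_iff
      sum_distrib_left mult_ac)

lemma matrix_mult_add_left: "(A + B) ** C = A ** C + B ** (C :: real^'n^'m)"
  by (simp add: matrix_matrix_mult_def vec_eq_iff sum.distrib distrib_right)

text \<open>On matrices \<open>\<bullet>\<close> is the Frobenius inner product. Bilinear forms thus
  become inner products with rank-one matrices, to which Cauchy-Schwarz applies.\<close>

lemma inner_outer: "X \<bullet> outer a b = a \<bullet> (X *v b)"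
  by (simp add: outer_def matrix_vector_mult_def inner_vec_def sum_distrib_left mult_ac)

lemma trace_outer: "trace (outer a a) = (norm a)\<^sup>2"
  by (simp add: trace_def outer_def power2_norm_eq_inner inner_vec_def)

lemma trace_scaleR: "trace (c *\<^sub>R A) = c * trace A" for A :: "real^'n^'n"
  by (simp add: trace_def sum_distrib_left)

definition symmetric_psd :: "real^'n^'n \<Rightarrow> bool" where
  "symmetric_psd A \<longleftrightarrow> transpose A = A \<and> (\<forall>x. 0 \<le> x \<bullet> (A *v x))"

lemma symmetric_psd_add_outer:
  assumes "symmetric_psd A"
  shows "symmetric_psd (A + outer r r)"
proof -
  have "transpose (A + outer r r) = transpose A + outer r r"
    by (simp add: transpose_def outer_def vec_eq_iff mult.commute)
  moreover have "0 \<le> x \<bullet> ((A + outer r r) *v x)" for x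
  proof -
    have "x \<bullet> ((A + outer r r) *v x) = x \<bullet> (A *v x) + (r \<bullet> x)\<^sup>2"
      by (simp add: matrix_vector_mult_add_rdistrib outer_mult_vector inner_add_right inner_commute power2_eq_square)
    then show ?thesis using assms by (simp add: symmetric_psd_def)
  qed
  ultimately show ?thesis using assms by (simp add: symmetric_psd_def)
qed

lemma symmetric_psd_0: "symmetric_psd 0"
  by (simp add: symmetric_psd_def transpose_def vec_eq_iff matrix_vector_mult_def inner_vec_def)

lemma trace_nonneg:
  fixes A :: "real^'n^'n"
  assumes "symmetric_psd A"
  shows "0 \<le> trace A"
proof -
  have "A $ i $ i = axis i 1 \<bullet> (A *v axis i 1)" for i
    by (simp add: matrix_vector_mult_basis inner_axis' column_def)
  then have "0 \<le> A $ i $ i" for i using assms by (simp add: symmetric_psd_def)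
  then show ?thesis by (simp add: trace_def sum_nonneg)
qed

section \<open>The inverse of a shifted positive semidefinite matrix and its rank-one
  updates\<close>

locale ridge =
  fixes A :: "real^'n^'n" and c :: real
  assumes A: "symmetric_psd A" and pos: "c > 0"
begin

definition "H = A + c *\<^sub>R mat 1"
definition "K = matrix_inv H"

lemma H_vector: "H *v x = A *v x + c *\<^sub>R x"
  by (simp add: H_def matrix_vector_mult_add_rdistrib scaleR_matrix_vector_assoc[symmetric])

lemma H_coercive: "c * (norm x)\<^sup>2 \<le> x \<bullet> (H *v x)"
  using A by (simp add: H_vector inner_add_right symmetric_psd_def power2_norm_eq_inner)

lemma inverse: "H ** K = mat 1" "K ** H = mat 1"
proof -
  have "x = 0" if "H *v x = 0" for x
    using H_coercive[of x] that pos by (simp add: mult_le_0_iff)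
  then have "invertible H"
    using matrix_left_invertible_ker invertible_left_inverse by blast
  then show "H ** K = mat 1" "K ** H = mat 1"
    using someI_ex[of "\<lambda>B. H ** B = mat 1 \<and> B ** H = mat 1"]
    by (auto simp: K_def matrix_inv_def invertible_def)
qed

lemma H_K_vector: "H *v (K *v x) = x"
  by (simp add: matrix_vector_mul_assoc inverse)

lemma K_symmetric: "transpose K = K"
proof -
  have "transpose H = H"
    using A by (simp add: H_def symmetric_psd_def transpose_def mat_def vec_eq_iff)
  then have "transpose K ** H = mat 1"
    by (metis inverse(1) matrix_transpose_mul transpose_mat)
  then show ?thesis
    by (metis inverse(1) matrix_mul_assoc matrix_mul_lid matrix_mul_rid)
qed

lemma symmetric_psd_K: "symmetric_psd K"
proof -
  have "0 \<le> x \<bullet> (K *v x)" for x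
  proof -
    have "0 \<le> c * (norm (K *v x))\<^sup>2" using pos by simp
    also have "\<dots> \<le> (K *v x) \<bullet> x" using H_coercive[of "K *v x"] by (simp add: H_K_vector)
    finally show ?thesis by (simp add: inner_commute)
  qed
  then show ?thesis using K_symmetric by (simp add: symmetric_psd_def)
qed

text \<open>Coercivity of \<open>H\<close> at \<open>K *v x\<close>, then Cauchy-Schwarz and
  cancellation of one factor \<open>norm (K *v x)\<close>.\<close>

lemma norm_K_le: "norm (K *v x) \<le> norm x / c"
proof (cases "K *v x = 0")
  case True
  then show ?thesis using pos by simp
next
  case False
  have "c * (norm (K *v x))\<^sup>2 \<le> (K *v x) \<bullet> x" using H_coercive[of "K *v x"] by (simp add: H_K_vector)
  also have "\<dots> \<le> norm (K *v x) * norm x" by (rule norm_cauchy_schwarz)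
  finally have "(c * norm (K *v x)) * norm (K *v x) \<le> norm x * norm (K *v x)"
    by (simp add: power2_eq_square mult_ac)
  then have "c * norm (K *v x) \<le> norm x"
    using False by (simp add: mult_le_cancel_right)
  then show ?thesis using pos by (simp add: field_simps)
qed

lemma gain_nonneg: "0 \<le> r \<bullet> (K *v r)"
  using symmetric_psd_K by (simp add: symmetric_psd_def)

text \<open>Applying the updated matrix to \<open>?K' *v x\<close> gives \<open>x\<close> plus a
  multiple of \<open>r\<close> whose coefficient vanishes by the choice of \<open>\<beta>\<close>.
  This right inverse is the inverse, since the updated matrix is again an instance of
  \<open>ridge\<close>.\<close>

lemma Sherman_Morrison:
  "matrix_inv (A + outer r r + c *\<^sub>R mat 1)
    = K - (1 / (1 + r \<bullet> (K *v r))) *\<^sub>R outer (K *v r) (K *v r)" (is "_ = ?K'")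
proof -
  interpret upd: ridge "A + outer r r" c
    using A pos by unfold_locales (auto intro: symmetric_psd_add_outer)
  let ?m = "K *v r"
  define \<beta> where "\<beta> = 1 / (1 + r \<bullet> ?m)"
  have \<beta>: "\<beta> * (1 + r \<bullet> ?m) = 1" using gain_nonneg[of r] by (simp add: \<beta>_def)
  have H': "upd.H *v y = H *v y + (r \<bullet> y) *\<^sub>R r" for y
    by (simp add: upd.H_vector H_vector matrix_vector_mult_add_rdistrib outer_mult_vector)
  have "upd.H *v (?K' *v x) = x" for x
  proof -
    have K': "?K' *v x = K *v x - (\<beta> * (?m \<bullet> x)) *\<^sub>R ?m"
      by (simp add: \<beta>_def matrix_vector_mult_diff_rdistrib outer_mult_vector
          scaleR_matrix_vector_assoc[symmetric])
    have rK: "r \<bullet> (K *v x) = ?m \<bullet> x"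
      by (simp add: inner_matrix_vector K_symmetric del: transpose_matrix_vector)
    have "upd.H *v (?K' *v x) = x + ((?m \<bullet> x) * (1 - \<beta> * (1 + r \<bullet> ?m))) *\<^sub>R r"
      unfolding H' K' matrix_vector_mult_diff_distrib matrix_vector_mult_scaleR H_K_vector
        inner_diff_right inner_scaleR_right rK
      by (simp add: algebra_simps)
    then show ?thesis by (simp add: \<beta>)
  qed
  then have "upd.H ** ?K' = mat 1"
    by (simp add: matrix_eq matrix_vector_mul_assoc[symmetric])
  then have "?K' = upd.K"
    by (metis upd.inverse(2) matrix_mul_assoc matrix_mul_lid matrix_mul_rid)
  then show ?thesis by (simp add: upd.K_def upd.H_def)
qed

end

section \<open>Measurability of matrix operations and Frobenius estimates\<close>

lemma borel_measurable_matrix_vector_mult [measurable (raw)]: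
  fixes f :: "'x \<Rightarrow> real^'n^'m"
  assumes [measurable]: "f \<in> borel_measurable N" "g \<in> borel_measurable N"
  shows "(\<lambda>x. f x *v g x) \<in> borel_measurable N"
proof -
  have "(\<lambda>x. fst x *v snd x) \<in> borel_measurable (borel :: ((real^'n^'m) \<times> (real^'n)) measure)"
    by (intro borel_measurable_continuous_onI continuous_intros)
  from measurable_compose[OF borel_measurable_Pair[OF assms] this] show ?thesis by simp
qed

lemma continuous_on_outer [continuous_intros]:
  "continuous_on S f \<Longrightarrow> continuous_on S g \<Longrightarrow> continuous_on S (\<lambda>x. outer (f x) (g x))"
  unfolding outer_def by (intro continuous_intros)

lemma borel_measurable_outer [measurable (raw)]:
  fixes f :: "'x \<Rightarrow> real^'n" and g :: "'x \<Rightarrow> real^'m"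
  assumes "f \<in> borel_measurable N" "g \<in> borel_measurable N"
  shows "(\<lambda>x. outer (f x) (g x)) \<in> borel_measurable N"
proof -
  have "(\<lambda>x. outer (fst x) (snd x)) \<in> borel_measurable (borel :: ((real^'n) \<times> (real^'m)) measure)"
    by (intro borel_measurable_continuous_onI continuous_intros)
  from measurable_compose[OF borel_measurable_Pair[OF assms] this] show ?thesis by simp
qed

lemma borel_measurable_matrix_mult [measurable (raw)]:
  fixes f :: "'x \<Rightarrow> real^'n^'m" and g :: "'x \<Rightarrow> real^'k^'n"
  assumes "f \<in> borel_measurable N" "g \<in> borel_measurable N"
  shows "(\<lambda>x. f x ** g x) \<in> borel_measurable N"
proof -
  have "(\<lambda>x. fst x ** snd x) \<in> borel_measurable (borel :: ((real^'n^'m) \<times> (real^'k^'n)) measure)"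
    unfolding matrix_matrix_mult_def
    by (intro borel_measurable_continuous_onI continuous_intros)
  from measurable_compose[OF borel_measurable_Pair[OF assms] this] show ?thesis by simp
qed

lemma norm_outer: "norm (outer a b) = norm a * norm b"
proof (rule power2_eq_imp_eq)
  show "(norm (outer a b))\<^sup>2 = (norm a * norm b)\<^sup>2"
    by (simp add: power2_norm_eq_inner[of "outer a b"] inner_outer outer_mult_vector power_mult_distrib
        power2_norm_eq_inner mult.commute)
qed simp_all

text \<open>The Frobenius product splits into the quadratic forms of \<open>K\<close> at the rows of
  \<open>X\<close>. It later gives the sign of the averaged descent term.\<close>

lemma inner_matrix_mult_psd:
  assumes "symmetric_psd K"
  shows "0 \<le> X \<bullet> (X ** K)"
proof -
  have "(X ** K) $ i = transpose K *v (X $ i)" for i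
    by (simp add: matrix_matrix_mult_def matrix_vector_mult_def transpose_def vec_eq_iff mult.commute)
  then show ?thesis
    using assms by (simp add: inner_vec_def[of X] symmetric_psd_def sum_nonneg del: transpose_matrix_vector)
qed

section \<open>The loss of a single sample\<close>

lemma restr_add: "restr g (a + b) = restr g a + restr g b"
  by (simp add: restr_def vec_eq_iff)

lemma restr_scaleR: "restr g (c *\<^sub>R a) = c *\<^sub>R restr g a"
  by (simp add: restr_def vec_eq_iff)

lemma group_norm_nonneg: "group_norm G s \<ge> 0"
  unfolding group_norm_def by (intro sum_nonneg infnorm_pos_le)

lemma group_norm_0: "group_norm G 0 = 0"
proof -
  have "restr g 0 = 0" for g :: "'a set"
    by (simp add: restr_def vec_eq_iff)
  then show ?thesis by (simp add: group_norm_def infnorm_0)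
qed

lemma group_norm_add: "group_norm G (a + b) \<le> group_norm G a + group_norm G b"
  unfolding group_norm_def sum.distrib[symmetric] restr_add
  by (intro sum_mono infnorm_triangle)

lemma group_norm_scaleR: "group_norm G (c *\<^sub>R a) = \<bar>c\<bar> * group_norm G a"
  by (simp add: group_norm_def restr_scaleR infnorm_mul sum_distrib_left)

lemma continuous_on_group_norm: "continuous_on S (group_norm G)"
proof -
  have "linear (restr g :: real^'a \<Rightarrow> _)" for g
    by (intro linearI restr_add restr_scaleR)
  then have "continuous_on S (restr g)" for g
    by (rule linear_continuous_on[OF linear_conv_bounded_linear[THEN iffD1]])
  then show ?thesis
    unfolding group_norm_def by (intro continuous_intros continuous_on_infnorm) auto
qed

lemma continuous_on_group_norm_compose [continuous_intros]:
  "continuous_on S f \<Longrightarrow> continuous_on S (\<lambda>x. group_norm G (f x))"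
  using continuous_on_compose2[OF continuous_on_group_norm[of UNIV]] by auto

lemma continuous_on_lhat [continuous_intros]:
  assumes "continuous_on S d" "continuous_on S L" "continuous_on S r" "continuous_on S s"
  shows "continuous_on S (\<lambda>x. lhat G l1 l2 (d x) (L x) (r x) (s x))"
  unfolding lhat_def by (intro continuous_intros assms)

lemma norm_half_sum_squared:
  fixes a b :: "'a::real_inner"
  shows "(norm ((1/2) *\<^sub>R (a + b)))\<^sup>2 \<le> ((norm a)\<^sup>2 + (norm b)\<^sup>2) / 2"
proof -
  have "0 \<le> (norm (a - b))\<^sup>2" by simp
  then show ?thesis
    by (simp add: power2_norm_eq_inner inner_diff_left inner_diff_right inner_add_left
        inner_add_right inner_commute field_simps)
qed

lemma norm_add_squared:
  fixes a b :: "'a::real_inner"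
  shows "(norm (a + b))\<^sup>2 = (norm a)\<^sup>2 + 2 * (a \<bullet> b) + (norm b)\<^sup>2"
  by (simp add: power2_norm_eq_inner inner_add_left inner_add_right inner_commute)

lemma linear_coeff_zero:
  fixes a b :: real
  assumes "\<And>x. 0 \<le> a * x + b * x\<^sup>2"
  shows "a = 0"
proof (rule ccontr)
  assume "a \<noteq> 0"
  \<comment> \<open>Any \<open>c\<close> above both 0 and \<open>b\<close> works: at
    \<open>x = - a / c\<close> the linear term outweighs the quadratic one.\<close>
  define c where "c = \<bar>b\<bar> + 1"
  have c: "c > 0" "b < c" by (auto simp: c_def)
  have "a * (- a / c) + b * (- a / c)\<^sup>2 = a\<^sup>2 * (b - c) / c\<^sup>2"
    using c by (simp add: field_simps power2_eq_square)
  also have "\<dots> < 0" using c \<open>a \<noteq> 0\<close>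
    by (intro divide_neg_pos mult_pos_neg) auto
  finally show False using assms[of "- a / c"] by simp
qed

locale lsd =
  fixes G :: "'p::finite set set" and l1 l2 :: real
  assumes l1_pos: "l1 > 0" and l2_pos: "l2 > 0"
begin

abbreviation "loss \<equiv> lhat G l1 l2"
abbreviation "cost \<equiv> ell G l1 l2"

definition optimal :: "real^'p \<Rightarrow> real^'r^'p \<Rightarrow> real^'r \<Rightarrow> real^'p \<Rightarrow> bool" where
  "optimal d L r s \<longleftrightarrow> (\<forall>r' s'. loss d L r s \<le> loss d L r' s')"

lemma loss_nonneg: "0 \<le> loss d L r s"
  using l1_pos l2_pos group_norm_nonneg[of G s] by (simp add: lhat_def)

lemma cost_le: "cost d L \<le> loss d L r s"
proof -
  have "bdd_below (range (\<lambda>rs. loss d L (fst rs) (snd rs)))"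
    using loss_nonneg by (intro bdd_belowI[of _ 0]) auto
  from cINF_lower[OF this, of "(r, s)"] show ?thesis by (simp add: ell_def)
qed

lemma cost_eq: "optimal d L r s \<Longrightarrow> cost d L = loss d L r s"
  unfolding ell_def optimal_def
  by (rule cInf_eq_minimum, rule range_eqI[of _ _ "(r, s)"]) auto

lemma cost_nonneg: "0 \<le> cost d L"
  unfolding ell_def by (intro cINF_greatest) (auto simp: loss_nonneg)

lemma cost_le_norm: "cost d L \<le> (norm d)\<^sup>2 / 2"
  using cost_le[of d L 0 0] by (simp add: lhat_def group_norm_0)

text \<open>The sublevel set of the pair \<open>(0, 0)\<close> is compact. The ridge term bounds
  \<open>r\<close>, and then the residual bounds \<open>s\<close>; the group norm cannot do this, as
  the groups may leave indices uncovered.\<close>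

lemma ex_optimal: "\<exists>r s. optimal d L r (s :: real^'p)" for L :: "real^'r^'p"
proof -
  define C where "C = {rs. loss d L (fst rs) (snd rs) \<le> loss d L 0 0}"
  have "closed C"
    unfolding C_def by (intro closed_Collect_le continuous_intros)
  moreover have "bounded C"
  proof -
    obtain B where B: "\<And>r. norm (L *v r) \<le> norm r * B"
      using bounded_linear.bounded[OF matrix_vector_mul_bounded_linear[of L]] by blast
    define R where "R = norm d / sqrt l1"
    have "norm (fst rs) \<le> R \<and> norm (snd rs) \<le> norm d + R * \<bar>B\<bar> + norm d" if "rs \<in> C" for rs
    proof -
      obtain r s where rs: "rs = (r, s)" by force
      have *: "(norm (d - L *v r - s))\<^sup>2 + l1 * (norm r)\<^sup>2 + 2 * l2 * group_norm G s \<le> (norm d)\<^sup>2"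
        using that by (simp add: rs C_def lhat_def group_norm_0)
      have **: "0 \<le> l1 * (norm r)\<^sup>2" "0 \<le> 2 * l2 * group_norm G s"
        "0 \<le> (norm (d - L *v r - s))\<^sup>2"
        using l1_pos l2_pos group_norm_nonneg[of G s] by simp_all
      have "(sqrt l1 * norm r)\<^sup>2 \<le> (norm d)\<^sup>2"
        using * ** l1_pos unfolding power_mult_distrib real_sqrt_pow2[OF less_imp_le[OF l1_pos]]
        by linarith
      then have "sqrt l1 * norm r \<le> norm d"
        by (rule power2_le_imp_le) simp
      then have r: "norm r \<le> R"
        using l1_pos by (simp add: R_def field_simps)
      have e: "norm (d - L *v r - s) \<le> norm d"
        by (rule power2_le_imp_le) (use * ** in linarith, simp)
      have "norm s \<le> norm d + norm (L *v r) + norm (d - L *v r - s)"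
        using norm_triangle_ineq4[of "d - L *v r" "d - L *v r - s"]
          norm_triangle_ineq4[of d "L *v r"] by simp
      also have "norm (L *v r) \<le> norm r * \<bar>B\<bar>"
        using B[of r] by (meson abs_ge_self mult_left_mono norm_ge_zero order_trans)
      also have "\<dots> \<le> R * \<bar>B\<bar>" using r by (intro mult_right_mono) auto
      finally show ?thesis using r e by (simp add: rs)
    qed
    then have "C \<subseteq> cball 0 R \<times> cball 0 (norm d + R * \<bar>B\<bar> + norm d)"
      by (auto simp: mem_Times_iff)
    then show ?thesis
      by (rule bounded_subset[rotated]) (intro bounded_Times bounded_cball)
  qed
  ultimately have "compact C" by (simp add: compact_eq_bounded_closed)
  moreover have "(0, 0) \<in> C" by (simp add: C_def)
  moreover have "continuous_on C (\<lambda>rs. loss d L (fst rs) (snd rs))"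
    by (intro continuous_intros)
  ultimately obtain rs where rs: "rs \<in> C"
    "\<And>x. x \<in> C \<Longrightarrow> loss d L (fst rs) (snd rs) \<le> loss d L (fst x) (snd x)"
    using continuous_attains_inf[of C "\<lambda>rs. loss d L (fst rs) (snd rs)"] by blast
  have "optimal d L (fst rs) (snd rs)"
    unfolding optimal_def
  proof (intro allI)
    fix r' s'
    show "loss d L (fst rs) (snd rs) \<le> loss d L r' s'"
    proof (cases "(r', s') \<in> C")
      case True
      then show ?thesis using rs(2) by force
    next
      case False
      then show ?thesis using rs(1) by (auto simp: C_def)
    qed
  qed
  then show ?thesis by blast
qed

text \<open>The first-order condition in \<open>r\<close> alone: with \<open>s\<close> fixed the
  nonsmooth group norm cancels, and the loss along a line \<open>r + x *\<^sub>R v\<close> is a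
  quadratic polynomial with minimum at 0.\<close>

lemma optimal_gradient:
  assumes "optimal d L r s"
  shows "transpose L *v (d - L *v r - s) = l1 *\<^sub>R r"
proof -
  define e where "e = d - L *v r - s"
  have "(l1 *\<^sub>R r - transpose L *v e) \<bullet> v = 0" for v
  proof (rule linear_coeff_zero)
    fix x
    have e: "d - L *v (r + x *\<^sub>R v) - s = e + (- x) *\<^sub>R (L *v v)"
      by (simp add: e_def matrix_vector_right_distrib matrix_vector_mult_scaleR)
    have "0 \<le> loss d L (r + x *\<^sub>R v) s - loss d L r s"
      using assms by (simp add: optimal_def)
    also have "\<dots> = (l1 *\<^sub>R r - transpose L *v e) \<bullet> v * x
        + ((norm (L *v v))\<^sup>2 / 2 + l1 / 2 * (norm v)\<^sup>2) * x\<^sup>2"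
      unfolding lhat_def e e_def[symmetric] norm_add_squared inner_diff_left
      by (simp add: inner_matrix_vector power_mult_distrib algebra_simps)
    finally show "0 \<le> \<dots>" .
  qed
  then have "l1 *\<^sub>R r - transpose L *v e = 0"
    by (metis inner_eq_zero_iff)
  then show ?thesis by (simp add: e_def)
qed

text \<open>Midpoint convexity in the data. The average of the two minimizers is a competitor at
  \<open>d\<close>, and its residual is the average of the two residuals.\<close>

lemma cost_midpoint: "2 * cost d L \<le> cost (d + h) L + cost (d - h) L" for L :: "real^'r^'p"
proof -
  obtain r s where 1: "optimal (d + h) L r s" using ex_optimal by blast
  obtain r' s' where 2: "optimal (d - h) L r' s'" using ex_optimal by blast
  let ?a = "d + h - L *v r - s" and ?b = "d - h - L *v r' - s'"
  have *: "d - L *v ((1/2) *\<^sub>R (r + r')) - (1/2) *\<^sub>R (s + s') = (1/2) *\<^sub>R (?a + ?b)"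
    by (simp add: matrix_vector_right_distrib matrix_vector_mult_scaleR vec_eq_iff field_simps)
  have "2 * loss d L ((1/2) *\<^sub>R (r + r')) ((1/2) *\<^sub>R (s + s'))
      = (norm ((1/2) *\<^sub>R (?a + ?b)))\<^sup>2 + l1 * (norm ((1/2) *\<^sub>R (r + r')))\<^sup>2
        + l2 * group_norm G (s + s')"
    unfolding lhat_def group_norm_scaleR * by simp
  also have "\<dots> \<le> ((norm ?a)\<^sup>2 + (norm ?b)\<^sup>2) / 2 + l1 * (((norm r)\<^sup>2 + (norm r')\<^sup>2) / 2)
        + l2 * (group_norm G s + group_norm G s')"
    using l1_pos l2_pos
    by (intro add_mono mult_left_mono norm_half_sum_squared group_norm_add) auto
  also have "\<dots> = loss (d + h) L r s + loss (d - h) L r' s'"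
    by (simp add: lhat_def algebra_simps add_divide_distrib)
  finally show ?thesis
    using cost_le[of d L "(1/2) *\<^sub>R (r + r')" "(1/2) *\<^sub>R (s + s')"] cost_eq[OF 1] cost_eq[OF 2]
    by linarith
qed

text \<open>The cost is differentiable in the data with the residual as gradient. Keeping the
  minimizer of \<open>d\<close> gives the upper bound for every \<open>h\<close>; the upper bound at
  \<open>- h\<close> and midpoint convexity give the lower one.\<close>

lemma cost_expansion:
  assumes "optimal d L r s"
  shows "\<bar>cost (d + h) L - cost d L - (d - L *v r - s) \<bullet> h\<bar> \<le> (norm h)\<^sup>2 / 2"
proof -
  have upper: "cost (d + h) L - cost d L - (d - L *v r - s) \<bullet> h \<le> (norm h)\<^sup>2 / 2" for h
  proof -
    have *: "d + h - L *v r - s = (d - L *v r - s) + h" by simp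
    have "cost (d + h) L \<le> loss (d + h) L r s" by (rule cost_le)
    also have "\<dots> = loss d L r s + (d - L *v r - s) \<bullet> h + (norm h)\<^sup>2 / 2"
      unfolding lhat_def * norm_add_squared by (simp add: algebra_simps)
    finally show ?thesis using cost_eq[OF assms] by simp
  qed
  have "cost (d - h) L - cost d L + (d - L *v r - s) \<bullet> h \<le> (norm h)\<^sup>2 / 2"
    using upper[of "- h"] by simp
  then show ?thesis
    using upper[of h] cost_midpoint[of d L h] by linarith
qed

text \<open>Expresses the residual through the cost alone. This yields both its uniqueness and its
  measurability.\<close>

lemma residual_limit:
  assumes "optimal d L r s"
  shows "(\<lambda>n. real (Suc n) * (cost (d + (1 / real (Suc n)) *\<^sub>R b) L - cost d L))
    \<longlonglongrightarrow> (d - L *v r - s) \<bullet> b"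
proof (rule LIMSEQ_I, goal_cases)
  case (1 \<epsilon>)
  have *: "\<bar>real (Suc n) * (cost (d + (1 / real (Suc n)) *\<^sub>R b) L - cost d L) - (d - L *v r - s) \<bullet> b\<bar>
      \<le> (norm b)\<^sup>2 / 2 * (1 / real (Suc n))" for n
  proof -
    define m where "m = real (Suc n)"
    have m: "m > 0" by (simp add: m_def)
    have "\<bar>m * (cost (d + (1 / m) *\<^sub>R b) L - cost d L) - (d - L *v r - s) \<bullet> b\<bar>
        = m * \<bar>cost (d + (1 / m) *\<^sub>R b) L - cost d L - (d - L *v r - s) \<bullet> ((1 / m) *\<^sub>R b)\<bar>"
    proof -
      have "m * (cost (d + (1 / m) *\<^sub>R b) L - cost d L) - (d - L *v r - s) \<bullet> b
        = m * (cost (d + (1 / m) *\<^sub>R b) L - cost d L - (d - L *v r - s) \<bullet> ((1 / m) *\<^sub>R b))"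
        using m by (simp add: right_diff_distrib)
      then show ?thesis using m by (simp add: abs_mult)
    qed
    also have "\<dots> \<le> m * ((norm ((1 / m) *\<^sub>R b))\<^sup>2 / 2)"
      using m by (intro mult_left_mono cost_expansion assms) auto
    also have "\<dots> = (norm b)\<^sup>2 / 2 * (1 / m)"
      using m by (simp add: power2_eq_square field_simps)
    finally show ?thesis by (simp add: m_def)
  qed
  have "(\<lambda>n. (norm b)\<^sup>2 / 2 * (1 / real (Suc n))) \<longlonglongrightarrow> (norm b)\<^sup>2 / 2 * 0"
    by (intro tendsto_intros LIMSEQ_Suc[OF lim_1_over_n])
  then obtain N where "\<And>n. n \<ge> N \<Longrightarrow> norm ((norm b)\<^sup>2 / 2 * (1 / real (Suc n)) - (norm b)\<^sup>2 / 2 * 0) < \<epsilon>"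
    using 1 LIMSEQ_D by blast
  then show ?case using * by (intro exI[of _ N]) (smt (verit, best) real_norm_def)
qed

lemma residual_unique:
  assumes "optimal d L r s" "optimal d L r' s'"
  shows "d - L *v r - s = d - L *v r' - s'"
proof -
  have "(d - L *v r - s) \<bullet> b = (d - L *v r' - s') \<bullet> b" for b
    using residual_limit[OF assms(1)] residual_limit[OF assms(2)] by (rule LIMSEQ_unique)
  then show ?thesis by (metis vector_eq_rdot)
qed

text \<open>A fixed function of data and basis, independent of the choice by
  \<open>residual_unique\<close>. Together with \<open>coefs\<close> it describes the iteration by
  functions that can be shown measurable.\<close>

definition residual :: "real^'p \<Rightarrow> real^'r^'p \<Rightarrow> real^'p" where
  "residual d L = (SOME e. \<exists>r s. optimal d L r s \<and> e = d - L *v r - s)"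

text \<open>The optimal coefficients, recovered from the residual by the first-order condition
  \<open>optimal_gradient\<close>.\<close>

definition coefs :: "real^'p \<Rightarrow> real^'r^'p \<Rightarrow> real^'r" where
  "coefs d L = (1 / l1) *\<^sub>R (transpose L *v residual d L)"

lemma residual_eq:
  assumes "optimal d L r s"
  shows "d - L *v r - s = residual d L"
proof -
  have "\<exists>r s. optimal d L r s \<and> residual d L = d - L *v r - s"
    unfolding residual_def by (rule someI_ex) (use assms in blast)
  then show ?thesis using residual_unique[OF assms] by metis
qed

lemma coefs_eq:
  assumes "optimal d L r s"
  shows "coefs d L = r"
  using optimal_gradient[OF assms] l1_pos
  by (simp add: coefs_def residual_eq[OF assms, symmetric])

lemma ex_optimal_coefs:
  obtains s where "optimal d L (coefs d L) s" "d - L *v coefs d L - s = residual d L"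
  using ex_optimal[of d L] coefs_eq residual_eq by metis

text \<open>Comparison with \<open>r = 0\<close> and \<open>s = 0\<close>. The bound does not
  involve \<open>L\<close>, which is what makes possibly unbounded iterates manageable.\<close>

lemma residual_coefs_bound: "(norm (residual d L))\<^sup>2 + l1 * (norm (coefs d L))\<^sup>2 \<le> (norm d)\<^sup>2"
proof -
  obtain s where s: "optimal d L (coefs d L) s" "d - L *v coefs d L - s = residual d L"
    using ex_optimal_coefs .
  have "loss d L (coefs d L) s \<le> loss d L 0 0"
    using s(1) by (simp add: optimal_def)
  moreover have "0 \<le> l2 * group_norm G s" using l2_pos group_norm_nonneg[of G s] by simp
  ultimately show ?thesis by (simp add: lhat_def s(2) group_norm_0)
qed

lemma norm_residual_le: "norm (residual d L) \<le> norm d"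
proof (rule power2_le_imp_le)
  have "0 \<le> l1 * (norm (coefs d L))\<^sup>2" using l1_pos by simp
  then show "(norm (residual d L))\<^sup>2 \<le> (norm d)\<^sup>2"
    using residual_coefs_bound[of d L] by linarith
qed simp

lemma norm_coefs_le: "norm (coefs d L) \<le> norm d / sqrt l1"
proof -
  have "(sqrt l1 * norm (coefs d L))\<^sup>2 \<le> (norm d)\<^sup>2"
    using residual_coefs_bound[of d L] l1_pos zero_le_power2[of "norm (residual d L)"]
    unfolding power_mult_distrib real_sqrt_pow2[OF less_imp_le[OF l1_pos]] by linarith
  then have "sqrt l1 * norm (coefs d L) \<le> norm d"
    by (rule power2_le_imp_le) simp
  then show ?thesis using l1_pos by (simp add: field_simps)
qed

text \<open>The minimizer for \<open>L\<close> is kept as a competitor for the updated basis. Only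
  this upper bound enters the descent estimate, and its quadratic error is uniform in
  \<open>L\<close> by \<open>norm_coefs_le\<close>.\<close>

lemma cost_rank_one_update:
  "cost d (L + outer a k) \<le> cost d L - (residual d L \<bullet> a) * (k \<bullet> coefs d L)
    + (norm a)\<^sup>2 * (k \<bullet> coefs d L)\<^sup>2 / 2"
proof -
  obtain s where s: "optimal d L (coefs d L) s" "d - L *v coefs d L - s = residual d L"
    using ex_optimal_coefs .
  let ?r = "coefs d L"
  have e: "d - (L + outer a k) *v ?r - s = residual d L + (- (k \<bullet> ?r)) *\<^sub>R a"
    by (simp add: matrix_vector_mult_add_rdistrib outer_mult_vector s(2)[symmetric])
  have "cost d (L + outer a k) \<le> loss d (L + outer a k) ?r s" by (rule cost_le)
  also have "\<dots> = loss d L ?r s - (residual d L \<bullet> a) * (k \<bullet> ?r) + (norm a)\<^sup>2 * (k \<bullet> ?r)\<^sup>2 / 2"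
    unfolding lhat_def e s(2) norm_add_squared by (simp add: algebra_simps power_mult_distrib)
  finally show ?thesis using cost_eq[OF s(1)] by simp
qed

section \<open>Measurability of the cost, the residual and the coefficients\<close>

lemma cost_measurable [measurable]:
  "(\<lambda>x. cost (fst x) (snd x)) \<in> borel_measurable (borel :: ((real^'p) \<times> (real^'r^'p)) measure)"
proof (rule borel_measurableI_less)
  fix y
  \<comment> \<open>The infimum runs over an uncountable family, but its strict sublevel sets are
    unions of open sets and hence open.\<close>
  have "{x \<in> space borel. cost (fst x) (snd x) < y}
     = (\<Union>rs. {x :: (real^'p) \<times> (real^'r^'p). loss (fst x) (snd x) (fst rs) (snd rs) < y})"
  proof -
    have "bdd_below (range (\<lambda>rs. loss d L (fst rs) (snd rs)))" for d and L :: "real^'r^'p"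
      using loss_nonneg by (intro bdd_belowI[of _ 0]) auto
    then show ?thesis
      by (simp add: ell_def cINF_less_iff set_eq_iff)
  qed
  moreover have "open (\<Union>rs. {x :: (real^'p) \<times> (real^'r^'p). loss (fst x) (snd x) (fst rs) (snd rs) < y})"
    by (intro open_UN ballI open_Collect_less continuous_intros)
  ultimately show "{x \<in> space borel. cost (fst x) (snd x) < y} \<in> sets (borel :: ((real^'p) \<times> (real^'r^'p)) measure)"
    by simp
qed

lemma cost_measurable_compose [measurable (raw)]:
  assumes [measurable]: "f \<in> borel_measurable N" "g \<in> borel_measurable N"
  shows "(\<lambda>x. cost (f x) (g x :: real^'r^'p)) \<in> borel_measurable N"
  using measurable_compose[OF borel_measurable_Pair[OF assms] cost_measurable] by simp

text \<open>Each coordinate is the pointwise limit of difference quotients of the cost, so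
  measurability passes from the cost to the chosen residual.\<close>

lemma residual_measurable [measurable (raw)]:
  assumes [measurable]: "f \<in> borel_measurable N" "g \<in> borel_measurable N"
  shows "(\<lambda>x. residual (f x) (g x :: real^'r^'p)) \<in> borel_measurable N"
proof (subst borel_measurable_euclidean_space, intro ballI)
  fix b :: "real^'p"
  show "(\<lambda>x. residual (f x) (g x) \<bullet> b) \<in> borel_measurable N"
  proof (rule borel_measurable_LIMSEQ_real)
    fix x
    obtain r s where "optimal (f x) (g x) r s" using ex_optimal by blast
    from residual_limit[OF this, of b]
    show "(\<lambda>n. real (Suc n) * (cost (f x + (1 / real (Suc n)) *\<^sub>R b) (g x) - cost (f x) (g x)))
        \<longlonglongrightarrow> residual (f x) (g x) \<bullet> b"
      unfolding residual_eq[OF \<open>optimal (f x) (g x) r s\<close>] .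
    show "(\<lambda>x. real (Suc n) * (cost (f x + (1 / real (Suc n)) *\<^sub>R b) (g x) - cost (f x) (g x)))
        \<in> borel_measurable N" for n
      by (intro borel_measurable_times borel_measurable_diff borel_measurable_const
          cost_measurable_compose borel_measurable_add assms)
  qed
qed

lemma coefs_measurable [measurable (raw)]:
  assumes [measurable]: "f \<in> borel_measurable N" "g \<in> borel_measurable N"
  shows "(\<lambda>x. coefs (f x) (g x :: real^'r^'p)) \<in> borel_measurable N"
proof -
  have "continuous_on UNIV (transpose :: real^'r^'p \<Rightarrow> _)"
    unfolding transpose_def by (intro continuous_intros)
  then have [measurable]: "transpose \<in> borel_measurable (borel :: (real^'r^'p) measure)"
    by (rule borel_measurable_continuous_onI)
  show ?thesis unfolding coefs_def by measurable
qed

end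

section \<open>A single trajectory\<close>

locale lsd_path = lsd G l1 l2 for G :: "'p::finite set set" and l1 l2 :: real +
  fixes d :: "nat \<Rightarrow> real^'p" and L :: "nat \<Rightarrow> real^'r::finite^'p" and r :: "nat \<Rightarrow> real^'r"
    and s :: "nat \<Rightarrow> real^'p" and A :: "nat \<Rightarrow> real^'r^'r" and B :: "nat \<Rightarrow> real^'r^'p" and b :: real
  assumes data_bound: "\<And>t. norm (d (Suc t)) \<le> b"
    and A_0: "A 0 = 0" and B_0: "B 0 = 0"
    and opt: "\<And>t. optimal (d (Suc t)) (L t) (r (Suc t)) (s (Suc t))"
    and A_Suc: "\<And>t. A (Suc t) = A t + outer (r (Suc t)) (r (Suc t))"
    and B_Suc: "\<And>t. B (Suc t) = B t + outer (d (Suc t) - s (Suc t)) (r (Suc t))"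
    and L_Suc: "\<And>t. L (Suc t) = B (Suc t) ** matrix_inv (A (Suc t) + l1 *\<^sub>R mat 1)"
begin

lemma symmetric_psd_A: "symmetric_psd (A t)"
  by (induction t) (auto simp: A_0 A_Suc symmetric_psd_0 intro: symmetric_psd_add_outer)

sublocale ridge "A t" l1 for t
  using symmetric_psd_A l1_pos by unfold_locales

definition "e t = residual (d (Suc t)) (L t)"
text \<open>The new coefficients are multiplied by the inverse before the update. Hence, given the
  past, \<open>m t\<close> is linear in the new coefficients.\<close>

definition "m t = K t *v r (Suc t)"
definition "gain t = r (Suc t) \<bullet> m t"

lemma r_eq: "r (Suc t) = coefs (d (Suc t)) (L t)"
  using coefs_eq[OF opt] by simp

lemma e_eq: "e t = d (Suc t) - s (Suc t) - L t *v r (Suc t)"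
  unfolding e_def residual_eq[OF opt, symmetric] by simp

lemma b_nonneg: "0 \<le> b"
  using data_bound[of 0] norm_ge_zero order_trans by blast

lemma norm_e: "norm (e t) \<le> b"
  unfolding e_def using norm_residual_le data_bound order_trans by blast

lemma norm_r: "norm (r (Suc t)) \<le> b / sqrt l1"
  unfolding r_eq using norm_coefs_le[of "d (Suc t)" "L t"] data_bound[of t] l1_pos
  by (meson divide_right_mono less_imp_le order_trans real_sqrt_ge_zero)

lemma K_0: "K 0 = (1 / l1) *\<^sub>R mat 1"
proof -
  have "H 0 ** ((1 / l1) *\<^sub>R mat 1) = mat 1"
    using l1_pos A_0 by (simp add: matrix_eq matrix_vector_mul_assoc[symmetric]
        scaleR_matrix_vector_assoc[symmetric] matrix_vector_mult_scaleR H_vector)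
  then show ?thesis
    by (metis inverse(2) matrix_mul_assoc matrix_mul_lid matrix_mul_rid)
qed

lemma K_Suc: "K (Suc t) = K t - (1 / (1 + gain t)) *\<^sub>R outer (m t) (m t)"
proof -
  have "K (Suc t) = matrix_inv (A (Suc t) + l1 *\<^sub>R mat 1)" by (simp only: K_def H_def)
  then show ?thesis
    unfolding gain_def m_def using Sherman_Morrison[of t "r (Suc t)"] by (simp only: A_Suc)
qed

lemma gain_ge_0: "0 \<le> gain t"
  unfolding gain_def m_def by (rule gain_nonneg)

lemma gain_le: "gain t \<le> b / sqrt l1 * norm (m t)"
proof -
  have "gain t \<le> norm (r (Suc t)) * norm (m t)"
    unfolding gain_def by (rule norm_cauchy_schwarz)
  also have "\<dots> \<le> b / sqrt l1 * norm (m t)"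
    using norm_r by (intro mult_right_mono) auto
  finally show ?thesis .
qed

lemma norm_m: "norm (m t) \<le> b / sqrt l1 / l1"
  unfolding m_def using norm_K_le[of t "r (Suc t)"] norm_r[of t] l1_pos
  by (meson divide_right_mono less_imp_le order_trans)

lemma gain_bound: "gain t \<le> (b / l1)\<^sup>2"
proof -
  have "gain t \<le> b / sqrt l1 * (b / sqrt l1 / l1)"
    using gain_le[of t] norm_m[of t] b_nonneg l1_pos
    by (meson mult_left_mono order_trans divide_nonneg_nonneg less_imp_le real_sqrt_ge_zero)
  also have "\<dots> = (b / l1)\<^sup>2"
    using l1_pos by (simp add: power2_eq_square field_simps)
  finally show ?thesis .
qed

lemma K_Suc_r: "K (Suc t) *v r (Suc t) = (1 / (1 + gain t)) *\<^sub>R m t"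
proof -
  have "K (Suc t) *v r (Suc t) = m t - (gain t / (1 + gain t)) *\<^sub>R m t"
    unfolding K_Suc matrix_vector_mult_diff_rdistrib scaleR_matrix_vector_assoc[symmetric] outer_mult_vector
    by (simp add: m_def gain_def inner_commute)
  also have "\<dots> = (1 - gain t / (1 + gain t)) *\<^sub>R m t" by (simp add: algebra_simps)
  also have "1 - gain t / (1 + gain t) = 1 / (1 + gain t)"
    using gain_ge_0[of t] by (simp add: field_simps)
  finally show ?thesis .
qed

text \<open>The trace of \<open>K t\<close> drops by \<open>norm (m t)\<close> squared over
  \<open>1 + gain t\<close>, stays nonnegative and starts at \<open>CARD('r) / l1\<close>;
  telescoping gives the bound. As a constant valid on every trajectory, it can later be
  integrated.\<close>

lemma sum_norm_m_squared: "(\<Sum>t<n. (norm (m t))\<^sup>2) \<le> (1 + (b / l1)\<^sup>2) * (CARD('r) / l1)"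
proof -
  have step: "(norm (m t))\<^sup>2 \<le> (1 + (b / l1)\<^sup>2) * (trace (K t) - trace (K (Suc t)))" for t
  proof -
    have "trace (K t) - trace (K (Suc t)) = (norm (m t))\<^sup>2 / (1 + gain t)"
      by (simp add: K_Suc trace_sub trace_scaleR trace_outer)
    then have "(norm (m t))\<^sup>2 = (1 + gain t) * (trace (K t) - trace (K (Suc t)))"
      and "0 \<le> trace (K t) - trace (K (Suc t))"
      using gain_ge_0[of t] by simp_all
    then show ?thesis using gain_bound[of t] by (metis add_left_mono mult_right_mono)
  qed
  have "(\<Sum>t<n. (norm (m t))\<^sup>2) \<le> (\<Sum>t<n. (1 + (b / l1)\<^sup>2) * (trace (K t) - trace (K (Suc t))))"
    by (intro sum_mono step)
  also have "\<dots> = (1 + (b / l1)\<^sup>2) * (trace (K 0) - trace (K n))"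
    using sum_lessThan_telescope'[of "\<lambda>t. trace (K t)" n] by (simp only: sum_distrib_left[symmetric])
  also have "\<dots> \<le> (1 + (b / l1)\<^sup>2) * trace (K 0)"
    using trace_nonneg[OF symmetric_psd_K[of n]] by (intro mult_left_mono) auto
  also have "trace (K 0) = CARD('r) / l1"
    by (simp add: K_0 trace_scaleR trace_I)
  finally show ?thesis .
qed

lemma summable_norm_m_squared: "summable (\<lambda>t. (norm (m t))\<^sup>2)"
  by (rule summableI_nonneg_bounded[OF _ sum_norm_m_squared]) simp

lemma m_tendsto_0: "(\<lambda>t. norm (m t)) \<longlonglongrightarrow> 0"
  using tendsto_real_sqrt[OF summable_LIMSEQ_zero[OF summable_norm_m_squared]] by simp

text \<open>The initial basis is arbitrary whereas \<open>B 0 = 0\<close>, so the identity starts at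
  index 1. This is the source of the conditions \<open>t \<ge> 1\<close> below.\<close>

lemma B_eq: "t \<ge> 1 \<Longrightarrow> B t = L t ** H t"
  by (cases t) (simp_all add: L_Suc inverse matrix_mul_assoc[symmetric] flip: K_def H_def)

lemma L_update:
  assumes "t \<ge> 1"
  shows "L (Suc t) = L t + outer (e t) ((1 / (1 + gain t)) *\<^sub>R m t)"
proof -
  let ?r = "r (Suc t)" and ?x = "d (Suc t) - s (Suc t)"
  have "H (Suc t) = A (Suc t) + l1 *\<^sub>R mat 1" by (rule H_def)
  then have "H (Suc t) = H t + outer ?r ?r" by (simp only: A_Suc H_def add_ac)
  \<comment> \<open>The new sample contributes \<open>L t ** outer ?r ?r\<close>, which completes
    \<open>H t\<close> to \<open>H (Suc t)\<close>, and the rank-one remainder carrying the residual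
    \<open>e t\<close>.\<close>
  then have "B (Suc t) = L t ** H (Suc t) + outer (e t) ?r"
    unfolding B_Suc B_eq[OF assms] e_eq
    by (simp add: matrix_add_ldistrib matrix_mult_outer)
       (simp add: outer_def vec_eq_iff algebra_simps)
  then have "L (Suc t) = (L t ** H (Suc t) + outer (e t) ?r) ** K (Suc t)"
    using L_Suc[of t] by (simp flip: K_def H_def)
  also have "\<dots> = L t + outer (e t) (K (Suc t) *v ?r)"
    by (simp add: matrix_mult_add_left matrix_mul_assoc[symmetric] inverse outer_mult_matrix K_symmetric
        del: transpose_matrix_vector)
  finally show ?thesis by (simp add: K_Suc_r)
qed

section \<open>The surrogate multiplied by t and its increments\<close>

definition objective :: "nat \<Rightarrow> real^'r^'p \<Rightarrow> real" where
  "objective t X = (\<Sum>i<t. loss (d (Suc i)) X (r (Suc i)) (s (Suc i))) + l1 / 2 * (norm X)\<^sup>2"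

text \<open>Expansion around \<open>L t\<close> in the direction \<open>Y\<close>. The normal
  equations \<open>B t = L t ** H t\<close> cancel the linear terms of the losses against that of
  the penalty, and the discarded quadratic terms are nonnegative.\<close>

lemma objective_minimal:
  assumes "t \<ge> 1"
  shows "objective t (L t) \<le> objective t X"
proof -
  define Y where "Y = X - L t"
  have X: "X = L t + Y" by (simp add: Y_def)
  let ?a = "\<lambda>i. d (Suc i) - s (Suc i) - L t *v r (Suc i)"
  have A: "A t = (\<Sum>i<t. outer (r (Suc i)) (r (Suc i)))"
    by (induction t) (simp_all add: A_0 A_Suc)
  have B: "B t = (\<Sum>i<t. outer (d (Suc i) - s (Suc i)) (r (Suc i)))"
    by (induction t) (simp_all add: B_0 B_Suc)
  have "(\<Sum>i<t. ?a i \<bullet> (Y *v r (Suc i))) = Y \<bullet> (\<Sum>i<t. outer (?a i) (r (Suc i)))"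
    by (simp add: inner_sum_right inner_outer)
  also have "(\<Sum>i<t. outer (?a i) (r (Suc i))) = B t - L t ** A t"
  proof -
    have "L t ** A t = (\<Sum>i<t. L t ** outer (r (Suc i)) (r (Suc i)))"
      unfolding A by (simp add: vec_eq_iff matrix_matrix_mult_def sum_distrib_left sum.swap[of _ UNIV])
    moreover have "outer (?a i) (r (Suc i))
        = outer (d (Suc i) - s (Suc i)) (r (Suc i)) - L t ** outer (r (Suc i)) (r (Suc i))" for i
      by (simp add: matrix_mult_outer) (simp add: outer_def vec_eq_iff algebra_simps)
    ultimately show ?thesis by (simp add: B sum_subtractf)
  qed
  also have "\<dots> = l1 *\<^sub>R L t"
  proof -
    have "L t ** (l1 *\<^sub>R mat 1) = l1 *\<^sub>R L t"
      by (simp add: matrix_eq matrix_vector_mul_assoc[symmetric] scaleR_matrix_vector_assoc[symmetric]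
          matrix_vector_mult_scaleR)
    then show ?thesis unfolding B_eq[OF assms] H_def by (simp add: matrix_add_ldistrib)
  qed
  finally have stat: "(\<Sum>i<t. ?a i \<bullet> (Y *v r (Suc i))) = l1 * (L t \<bullet> Y)"
    by (simp add: inner_commute)
  have "loss (d (Suc i)) X (r (Suc i)) (s (Suc i)) \<ge> loss (d (Suc i)) (L t) (r (Suc i)) (s (Suc i))
      - ?a i \<bullet> (Y *v r (Suc i))" for i
  proof -
    have 1: "d (Suc i) - X *v r (Suc i) - s (Suc i) = ?a i + - (Y *v r (Suc i))"
      by (simp add: X matrix_vector_mult_add_rdistrib)
    have 2: "d (Suc i) - L t *v r (Suc i) - s (Suc i) = ?a i" by simp
    show ?thesis unfolding lhat_def 1 2 norm_add_squared by simp
  qed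
  then have "(\<Sum>i<t. loss (d (Suc i)) X (r (Suc i)) (s (Suc i)))
      \<ge> (\<Sum>i<t. loss (d (Suc i)) (L t) (r (Suc i)) (s (Suc i)) - ?a i \<bullet> (Y *v r (Suc i)))"
    by (intro sum_mono)
  moreover have "l1 / 2 * (norm X)\<^sup>2 \<ge> l1 / 2 * (norm (L t))\<^sup>2 + l1 * (L t \<bullet> Y)"
    unfolding X norm_add_squared using l1_pos by (simp add: algebra_simps)
  ultimately show ?thesis
    unfolding objective_def by (simp add: sum_subtractf stat)
qed

text \<open>For the upper bound \<open>L t\<close> competes at time \<open>Suc t\<close>; for the
  lower bound \<open>L (Suc t)\<close> competes at time \<open>t\<close>. What remains is the change
  of the newest loss between the two bases.\<close>

lemma objective_increment:
  assumes t: "t \<ge> 1"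
  shows "\<bar>objective (Suc t) (L (Suc t)) - objective t (L t) - cost (d (Suc t)) (L t)\<bar>
    \<le> b\<^sup>2 * (b / sqrt l1) * norm (m t)"
proof -
  let ?loss = "\<lambda>X. loss (d (Suc t)) X (r (Suc t)) (s (Suc t))"
  have Suc: "objective (Suc t) X = objective t X + ?loss X" for X
    by (simp add: objective_def)
  have opt_cost: "cost (d (Suc t)) (L t) = ?loss (L t)" by (rule cost_eq[OF opt])
  have upper: "objective (Suc t) (L (Suc t)) \<le> objective t (L t) + cost (d (Suc t)) (L t)"
    using objective_minimal[of "Suc t" "L t"] by (simp add: Suc opt_cost)
  \<comment> \<open>The update multiplies the newest residual \<open>e t\<close> by
    \<open>1 - g\<close>, and \<open>g\<close> is at most a constant times
    \<open>norm (m t)\<close>.\<close>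
  define g where "g = gain t / (1 + gain t)"
  have g: "0 \<le> g" "g \<le> gain t"
    using gain_ge_0[of t] by (auto simp: g_def field_simps)
  have 1: "d (Suc t) - L (Suc t) *v r (Suc t) - s (Suc t) = e t + (- g) *\<^sub>R e t"
    by (simp add: L_update[OF t] matrix_vector_mult_add_rdistrib outer_mult_vector e_eq g_def
        gain_def inner_commute)
  have 2: "d (Suc t) - L t *v r (Suc t) - s (Suc t) = e t"
    by (simp add: e_eq)
  have "?loss (L (Suc t)) \<ge> ?loss (L t) - (norm (e t))\<^sup>2 * g"
    unfolding lhat_def 1 2 norm_add_squared by (simp add: power2_norm_eq_inner)
  moreover have "(norm (e t))\<^sup>2 * g \<le> b\<^sup>2 * (b / sqrt l1 * norm (m t))"
    using norm_e[of t] g gain_le[of t] by (intro mult_mono power_mono) auto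
  moreover have "objective t (L t) \<le> objective t (L (Suc t))"
    by (rule objective_minimal[OF t])
  moreover have "0 \<le> b\<^sup>2 * (b / sqrt l1 * norm (m t))"
    using b_nonneg l1_pos by simp
  ultimately show ?thesis
    using upper by (simp add: Suc opt_cost abs_le_iff mult.assoc)
qed

end

section \<open>Almost sure convergence\<close>

locale lsd_law = lsd G l1 l2 + law: prob_space D
  for G :: "'p::finite set set" and l1 l2 :: real and D :: "(real^'p) measure" +
  fixes b :: real
  assumes sets_D [measurable_cong]: "sets D = sets borel"
    and D_bound: "AE y in D. norm y \<le> b"
begin

abbreviation "f \<equiv> exp_cost G l1 l2 D"

text \<open>The gradient of \<open>f\<close> at \<open>X\<close> is \<open>- correlation X\<close>.\<close>

definition correlation :: "real^'r^'p \<Rightarrow> real^'r^'p" where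
  "correlation X = (\<integral>y. outer (residual y X) (coefs y X) \<partial>D)"

lemma integrable_cost: "integrable D (\<lambda>y. cost y X)"
proof (rule law.integrable_const_bound)
  show "AE y in D. norm (cost y X) \<le> b\<^sup>2 / 2"
    using D_bound
  proof eventually_elim
    case (elim y)
    then have "(norm y)\<^sup>2 \<le> b\<^sup>2" by (intro power_mono) auto
    then show ?case using cost_nonneg[of y X] cost_le_norm[of y X] by simp
  qed
qed measurable

lemma f_nonneg: "0 \<le> f X"
  unfolding exp_cost_def by (intro integral_nonneg_AE) (simp add: cost_nonneg)

lemma b_nonneg: "0 \<le> b"
proof -
  have "AE y in D. 0 \<le> b" using D_bound by eventually_elim (use norm_ge_zero order_trans in blast)
  then show ?thesis by simp
qed

lemma norm_outer_le:
  "norm y \<le> b \<Longrightarrow> norm (outer (residual y X) (coefs y X)) \<le> b * (b / sqrt l1)"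
  unfolding norm_outer using norm_residual_le[of y X] norm_coefs_le[of y X] l1_pos b_nonneg
    divide_right_mono[of "norm y" b "sqrt l1"]
  by (intro mult_mono) auto

lemma integrable_outer: "integrable D (\<lambda>y. outer (residual y X) (coefs y X))"
proof (rule law.integrable_const_bound)
  show "AE y in D. norm (outer (residual y X) (coefs y X)) \<le> b * (b / sqrt l1)"
    using D_bound by eventually_elim (rule norm_outer_le)
qed measurable

lemma norm_correlation: "norm (correlation X) \<le> b * (b / sqrt l1)"
proof -
  have "norm (correlation X) \<le> (\<integral>y. norm (outer (residual y X) (coefs y X)) \<partial>D)"
    unfolding correlation_def by (rule integral_norm_bound)
  also have "\<dots> \<le> (\<integral>y. b * (b / sqrt l1) \<partial>D)"
    using D_bound norm_outer_le[of _ X] integrable_outer[of X]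
    by (intro integral_mono_AE) auto
  finally show ?thesis by (simp add: law.prob_space)
qed

lemma borel_measurable_correlation:
  "correlation \<in> borel_measurable (borel :: (real^'r^'p) measure)"
proof -
  have "(\<lambda>X. \<integral>y. outer (residual y X) (coefs y X) \<partial>D) \<in> borel_measurable (borel :: (real^'r^'p) measure)"
    by (rule law.borel_measurable_lebesgue_integral) measurable
  then show ?thesis by (simp add: correlation_def[abs_def])
qed

lemma inner_correlation: "(\<integral>y. X \<bullet> outer (residual y Y) (coefs y Y) \<partial>D) = X \<bullet> correlation Y"
  unfolding correlation_def by (rule integral_inner_right) (rule integrable_outer)

text \<open>The bound \<open>cost_rank_one_update\<close> integrated over the law: its linear term
  becomes an inner product with \<open>correlation X\<close>, and its quadratic term is bounded for
  almost every sample independently of \<open>X\<close>.\<close>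

lemma f_rank_one_update:
  "f (X + outer a k) \<le> f X - a \<bullet> (correlation X *v k)
    + (norm a)\<^sup>2 * ((b / sqrt l1)\<^sup>2 * (norm k)\<^sup>2) / 2"
proof -
  let ?c = "(norm a)\<^sup>2 * ((b / sqrt l1)\<^sup>2 * (norm k)\<^sup>2) / 2"
  have "f (X + outer a k) \<le> (\<integral>y. cost y X - outer a k \<bullet> outer (residual y X) (coefs y X) + ?c \<partial>D)"
    unfolding exp_cost_def
  proof (rule integral_mono_AE)
    show "AE y in D. cost y (X + outer a k) \<le> cost y X - outer a k \<bullet> outer (residual y X) (coefs y X) + ?c"
      using D_bound
    proof eventually_elim
      case (elim y)
      have "norm (coefs y X) \<le> b / sqrt l1"
        using norm_coefs_le[of y X] elim l1_pos
        by (meson divide_right_mono less_imp_le order_trans real_sqrt_ge_zero)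
      then have "\<bar>k \<bullet> coefs y X\<bar> \<le> b / sqrt l1 * norm k"
        using Cauchy_Schwarz_ineq2[of k "coefs y X"]
        by (metis mult.commute mult_right_mono norm_ge_zero order_trans)
      from power_mono[OF this, of 2]
      have "(k \<bullet> coefs y X)\<^sup>2 \<le> (b / sqrt l1)\<^sup>2 * (norm k)\<^sup>2"
        by (simp only: power_mult_distrib power2_abs)
      then have "(norm a)\<^sup>2 * (k \<bullet> coefs y X)\<^sup>2 \<le> (norm a)\<^sup>2 * ((b / sqrt l1)\<^sup>2 * (norm k)\<^sup>2)"
        by (rule mult_left_mono) simp
      moreover have "outer a k \<bullet> outer (residual y X) (coefs y X) = (residual y X \<bullet> a) * (k \<bullet> coefs y X)"
        by (simp add: inner_outer outer_mult_vector)
      ultimately show ?case using cost_rank_one_update[of y X a k] by linarith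
    qed
  qed (intro Bochner_Integration.integrable_add Bochner_Integration.integrable_diff
      integrable_inner_right integrable_cost integrable_outer law.integrable_const)+
  also have "\<dots> = f X - outer a k \<bullet> correlation X + ?c"
    using integrable_cost[of X] integrable_outer[of X]
    by (simp add: exp_cost_def inner_correlation[symmetric] law.prob_space)
  also have "outer a k \<bullet> correlation X = a \<bullet> (correlation X *v k)"
    by (simp add: inner_commute[of "outer a k"] inner_outer)
  finally show ?thesis .
qed

end

section \<open>The iteration as an adapted random process\<close>

locale olsd = lsd G l1 l2 + iid_sequence M d
  for G :: "'p::finite set set" and l1 l2 :: real
    and M :: "'w measure" and d :: "nat \<Rightarrow> 'w \<Rightarrow> real^'p" +
  fixes L0 :: "real^'r::finite^'p" and L :: "nat \<Rightarrow> 'w \<Rightarrow> real^'r^'p" and r :: "nat \<Rightarrow> 'w \<Rightarrow> real^'r"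
    and s :: "nat \<Rightarrow> 'w \<Rightarrow> real^'p" and A :: "nat \<Rightarrow> 'w \<Rightarrow> real^'r^'r" and B :: "nat \<Rightarrow> 'w \<Rightarrow> real^'r^'p"
    and b :: real
  assumes L_0: "\<And>\<omega>. \<omega> \<in> space M \<Longrightarrow> L 0 \<omega> = L0"
    and path: "\<And>\<omega>. \<omega> \<in> space M \<Longrightarrow>
      lsd_path G l1 l2 (\<lambda>t. d t \<omega>) (\<lambda>t. L t \<omega>) (\<lambda>t. r t \<omega>) (\<lambda>t. s t \<omega>) (\<lambda>t. A t \<omega>) (\<lambda>t. B t \<omega>) b"
begin

lemma data_bound: "\<omega> \<in> space M \<Longrightarrow> norm (d (Suc t) \<omega>) \<le> b"
  using lsd_path.data_bound[OF path] .

sublocale lsd_law G l1 l2 law b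
proof -
  interpret law: prob_space law by (rule prob_space_law)
  show "lsd_law l1 l2 law b"
  proof
    have "{y. norm y \<le> b} \<in> sets (borel :: (real^'p) measure)" by measurable
    then show "AE y in law. norm y \<le> b"
      unfolding law_def using rv[of 1] data_bound[of _ 0] by (subst AE_distr_iff) auto
  qed simp
qed

text \<open>The given minimizers \<open>r\<close> and \<open>s\<close> come without measurability.
  Writing these quantities with \<open>coefs\<close> and \<open>residual\<close> makes them
  measurable functions of the past and the new sample.\<close>

definition "K t \<omega> = matrix_inv (A t \<omega> + l1 *\<^sub>R mat 1)"
definition "e t \<omega> = residual (d (Suc t) \<omega>) (L t \<omega>)"
definition "m t \<omega> = K t \<omega> *v coefs (d (Suc t) \<omega>) (L t \<omega>)"

context
  fixes \<omega> assumes \<omega>: "\<omega> \<in> space M"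
begin

interpretation p: lsd_path G l1 l2 "\<lambda>t. d t \<omega>" "\<lambda>t. L t \<omega>" "\<lambda>t. r t \<omega>" "\<lambda>t. s t \<omega>"
  "\<lambda>t. A t \<omega>" "\<lambda>t. B t \<omega>" b
  by (rule path[OF \<omega>])

lemma K_eq: "K t \<omega> = p.K t"
  by (simp only: K_def p.K_def p.H_def)

lemma m_eq: "m t \<omega> = p.m t"
  by (simp only: m_def p.m_def K_eq p.r_eq)

lemma e_eq: "e t \<omega> = p.e t"
  by (simp only: e_def p.e_def)

lemma K_0: "K 0 \<omega> = (1 / l1) *\<^sub>R mat 1"
  unfolding K_eq by (rule p.K_0)

lemma K_Suc: "K (Suc t) \<omega> = K t \<omega>
    - (1 / (1 + coefs (d (Suc t) \<omega>) (L t \<omega>) \<bullet> m t \<omega>)) *\<^sub>R outer (m t \<omega>) (m t \<omega>)"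
  using p.K_Suc[of t] by (simp only: K_eq m_eq p.gain_def p.r_eq)

lemma B_0: "B 0 \<omega> = 0"
  by (rule p.B_0)

text \<open>\<open>d - s\<close> is eliminated as residual plus fitted part, so that the recursion
  involves only measurable functions.\<close>

lemma B_Suc: "B (Suc t) \<omega> = B t \<omega>
    + outer (e t \<omega> + L t \<omega> *v coefs (d (Suc t) \<omega>) (L t \<omega>)) (coefs (d (Suc t) \<omega>) (L t \<omega>))"
  using p.B_Suc[of t] by (simp add: e_eq p.e_eq p.r_eq)

lemma L_Suc: "L (Suc t) \<omega> = B (Suc t) \<omega> ** K (Suc t) \<omega>"
  using p.L_Suc[of t] by (simp only: K_def)

lemma symmetric_psd_K: "symmetric_psd (K t \<omega>)"
  unfolding K_eq by (rule p.symmetric_psd_K)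

lemma norm_K_le: "norm (K t \<omega> *v x) \<le> norm x / l1"
  unfolding K_eq by (rule p.norm_K_le)

lemma sum_norm_m_squared: "(\<Sum>t<n. (norm (m t \<omega>))\<^sup>2) \<le> (1 + (b / l1)\<^sup>2) * (CARD('r) / l1)"
  unfolding m_eq by (rule p.sum_norm_m_squared)

lemma summable_norm_m_squared: "summable (\<lambda>t. (norm (m t \<omega>))\<^sup>2)"
  unfolding m_eq by (rule p.summable_norm_m_squared)

text \<open>The actual step has the factor \<open>1 / (1 + g)\<close>, which depends on the new
  sample. Replacing it by 1 leaves a term whose average can be computed; the replacement and the
  quadratic remainder cost one unit each of the final constant 2.\<close>

lemma f_descent:
  assumes t: "t \<ge> 1"
  shows "f (L (Suc t) \<omega>) \<le> f (L t \<omega>) - e t \<omega> \<bullet> (correlation (L t \<omega>) *v m t \<omega>)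
    + 2 * b\<^sup>2 * (b / sqrt l1)\<^sup>2 * (norm (m t \<omega>))\<^sup>2"
proof -
  define g where "g = p.gain t"
  have g: "0 \<le> g" "g \<le> b / sqrt l1 * norm (m t \<omega>)"
    using p.gain_ge_0[of t] p.gain_le[of t] by (auto simp: g_def m_eq)
  let ?k = "(1 / (1 + g)) *\<^sub>R m t \<omega>" and ?c = "b / sqrt l1"
  define q where "q = e t \<omega> \<bullet> (correlation (L t \<omega>) *v m t \<omega>)"
  have e: "norm (e t \<omega>) \<le> b" using p.norm_e by (simp add: e_eq)
  have c0: "0 \<le> ?c" using b_nonneg l1_pos by simp
  have q: "\<bar>q\<bar> \<le> b * ?c * (b * norm (m t \<omega>))"
  proof -
    have "\<bar>q\<bar> \<le> norm (correlation (L t \<omega>)) * norm (outer (e t \<omega>) (m t \<omega>))"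
      unfolding q_def inner_outer[symmetric] by (rule Cauchy_Schwarz_ineq2)
    also have "\<dots> \<le> b * ?c * (b * norm (m t \<omega>))"
      unfolding norm_outer using norm_correlation[of "L t \<omega>"] e b_nonneg l1_pos by (intro mult_mono) auto
    finally show ?thesis .
  qed
  have "L (Suc t) \<omega> = L t \<omega> + outer (e t \<omega>) ?k"
    using p.L_update[OF t] by (simp only: e_eq m_eq g_def)
  then have "f (L (Suc t) \<omega>) \<le> f (L t \<omega>) - e t \<omega> \<bullet> (correlation (L t \<omega>) *v ?k)
      + (norm (e t \<omega>))\<^sup>2 * (?c\<^sup>2 * (norm ?k)\<^sup>2) / 2"
    using f_rank_one_update by metis
  also have "e t \<omega> \<bullet> (correlation (L t \<omega>) *v ?k) = q / (1 + g)"
    by (simp add: q_def matrix_vector_mult_scaleR)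
  also have "q / (1 + g) = q - q * (g / (1 + g))"
    using g by (simp add: field_simps)
  also have "q * (g / (1 + g)) \<le> \<bar>q\<bar> * g"
  proof -
    have "q * (g / (1 + g)) \<le> \<bar>q\<bar> * (g / (1 + g))" using g by (intro mult_right_mono) auto
    also have "\<dots> \<le> \<bar>q\<bar> * g" using g by (intro mult_left_mono) (auto simp: field_simps)
    finally show ?thesis .
  qed
  also have "\<bar>q\<bar> * g \<le> b * ?c * (b * norm (m t \<omega>)) * (?c * norm (m t \<omega>))"
    using q g b_nonneg c0 by (intro mult_mono) auto
  also have "(norm (e t \<omega>))\<^sup>2 * (?c\<^sup>2 * (norm ?k)\<^sup>2) / 2 \<le> b\<^sup>2 * (?c\<^sup>2 * (norm (m t \<omega>))\<^sup>2)"
  proof -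
    have "norm ?k \<le> norm (m t \<omega>)" using g by (simp add: field_simps mult_nonneg_nonneg)
    then have "(norm (e t \<omega>))\<^sup>2 * (?c\<^sup>2 * (norm ?k)\<^sup>2) \<le> b\<^sup>2 * (?c\<^sup>2 * (norm (m t \<omega>))\<^sup>2)"
      using e c0 b_nonneg by (intro mult_mono power_mono mult_nonneg_nonneg zero_le_power2) auto
    moreover have "0 \<le> b\<^sup>2 * (?c\<^sup>2 * (norm (m t \<omega>))\<^sup>2)" by simp
    ultimately show ?thesis by linarith
  qed
  finally show ?thesis
    by (simp add: q_def power2_eq_square algebra_simps)
qed

definition "total_cost t = real t * surrogate G l1 l2 (\<lambda>i. d i \<omega>) (\<lambda>i. r i \<omega>) (\<lambda>i. s i \<omega>) t (L t \<omega>)"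

lemma total_cost_increment:
  "(\<lambda>t. total_cost (Suc t) - total_cost t - cost (d (Suc t) \<omega>) (L t \<omega>)) \<longlonglongrightarrow> 0"
proof -
  have U: "total_cost t = p.objective t (L t \<omega>)" if "t \<ge> 1" for t
    using that
    by (simp add: total_cost_def surrogate_def p.objective_def sum.atLeast1_atMost_eq distrib_left)
  have "(\<lambda>t. b\<^sup>2 * (b / sqrt l1) * norm (m t \<omega>)) \<longlonglongrightarrow> b\<^sup>2 * (b / sqrt l1) * 0"
    unfolding m_eq by (intro tendsto_intros p.m_tendsto_0)
  then have *: "(\<lambda>t. b\<^sup>2 * (b / sqrt l1) * norm (m t \<omega>)) \<longlonglongrightarrow> 0" by simp
  show ?thesis
  proof (rule Lim_null_comparison[OF _ *])
    show "\<forall>\<^sub>F t in sequentially. norm (total_cost (Suc t) - total_cost t - cost (d (Suc t) \<omega>) (L t \<omega>))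
        \<le> b\<^sup>2 * (b / sqrt l1) * norm (m t \<omega>)"
      using eventually_ge_at_top[of 1]
    proof eventually_elim
      case (elim t)
      then show ?case using p.objective_increment[OF elim] U[of t] U[of "Suc t"] by (simp add: m_eq)
    qed
  qed
qed

end

text \<open>A joint induction, since the recursions are coupled. \<open>K\<close> is followed
  through its rank-one recursion in place of the matrix inverse, and \<open>measurable_cong\<close>
  is used because the recursions are derived on \<open>space M\<close>.\<close>

lemma measurable_history:
  "L t \<in> borel_measurable (history t) \<and> B t \<in> borel_measurable (history t) \<and> K t \<in> borel_measurable (history t)"
proof (induction t)
  case 0
  have "L 0 \<in> borel_measurable (history 0) \<longleftrightarrow> (\<lambda>_. L0) \<in> borel_measurable (history 0)"
    by (rule measurable_cong) (simp add: L_0)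
  moreover have "B 0 \<in> borel_measurable (history 0) \<longleftrightarrow> (\<lambda>_. 0 :: real^'r^'p) \<in> borel_measurable (history 0)"
    by (rule measurable_cong) (simp add: B_0)
  moreover have "K 0 \<in> borel_measurable (history 0) \<longleftrightarrow> (\<lambda>_. (1 / l1) *\<^sub>R mat 1 :: real^'r^'r) \<in> borel_measurable (history 0)"
    by (rule measurable_cong) (simp add: K_0)
  ultimately show ?case by simp
next
  case (Suc t)
  note [measurable] = Suc[THEN conjunct1, THEN history_measurable_Suc]
    Suc[THEN conjunct2, THEN conjunct1, THEN history_measurable_Suc]
    Suc[THEN conjunct2, THEN conjunct2, THEN history_measurable_Suc]
  have [measurable]: "d (Suc t) \<in> borel_measurable (history (Suc t))"
    by (rule data_in_history) auto
  have [measurable]: "m t \<in> borel_measurable (history (Suc t))" "e t \<in> borel_measurable (history (Suc t))"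
    unfolding m_def[abs_def] e_def[abs_def] by measurable
  have "B (Suc t) \<in> borel_measurable (history (Suc t)) \<longleftrightarrow> (\<lambda>\<omega>. B t \<omega>
      + outer (e t \<omega> + L t \<omega> *v coefs (d (Suc t) \<omega>) (L t \<omega>)) (coefs (d (Suc t) \<omega>) (L t \<omega>)))
      \<in> borel_measurable (history (Suc t))"
    by (rule measurable_cong) (simp add: B_Suc)
  then have B [measurable]: "B (Suc t) \<in> borel_measurable (history (Suc t))" by simp
  have "K (Suc t) \<in> borel_measurable (history (Suc t)) \<longleftrightarrow> (\<lambda>\<omega>. K t \<omega>
      - (1 / (1 + coefs (d (Suc t) \<omega>) (L t \<omega>) \<bullet> m t \<omega>)) *\<^sub>R outer (m t \<omega>) (m t \<omega>))
      \<in> borel_measurable (history (Suc t))"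
    by (rule measurable_cong) (simp add: K_Suc)
  then have K [measurable]: "K (Suc t) \<in> borel_measurable (history (Suc t))" by simp
  have "L (Suc t) \<in> borel_measurable (history (Suc t))
      \<longleftrightarrow> (\<lambda>\<omega>. B (Suc t) \<omega> ** K (Suc t) \<omega>) \<in> borel_measurable (history (Suc t))"
    by (rule measurable_cong) (simp add: L_Suc)
  then show ?case using B K by simp
qed

lemma L_measurable [measurable]: "L t \<in> borel_measurable (history t)"
  and K_measurable [measurable]: "K t \<in> borel_measurable (history t)"
  using measurable_history by auto

text \<open>A strong law: \<open>L t\<close> depends only on earlier samples, so the centred costs
  are bounded martingale differences. Divided by \<open>Suc n\<close> they have summable second
  moments, and Kronecker's lemma removes the weights.\<close>

lemma AE_cost_average:
  "AE \<omega> in M. (\<lambda>n. (\<Sum>t<n. cost (d (Suc t) \<omega>) (L t \<omega>) - f (L t \<omega>)) / real n) \<longlonglongrightarrow> 0"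
proof -
  define h where "h n \<omega> y = cost y (L n \<omega>) / real (Suc n)" for n \<omega> y
  have bound: "\<bar>h n \<omega> (d (Suc n) \<omega>')\<bar> \<le> b\<^sup>2 / 2 / real (Suc n)" if "\<omega>' \<in> space M" for n \<omega> \<omega>'
  proof -
    have "cost (d (Suc n) \<omega>') (L n \<omega>) \<le> b\<^sup>2 / 2"
      using cost_le_norm[of "d (Suc n) \<omega>'" "L n \<omega>"] power_mono[OF data_bound[OF that, of n], of 2] by simp
    then have "h n \<omega> (d (Suc n) \<omega>') \<le> b\<^sup>2 / 2 / real (Suc n)"
      unfolding h_def by (rule divide_right_mono) simp
    then show ?thesis
      using cost_nonneg[of "d (Suc n) \<omega>'" "L n \<omega>"] by (simp add: h_def)
  qed
  have fresh: "fresh_sample M d n (h n) (b\<^sup>2 / 2 / real (Suc n))" for n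
  proof
    show "(\<lambda>(\<omega>, y). h n \<omega> y) \<in> borel_measurable (history n \<Otimes>\<^sub>M borel)"
      unfolding h_def by measurable
  qed (rule bound)
  have "summable (\<lambda>n. (b\<^sup>2 / 2)\<^sup>2 * inverse (real (Suc n) ^ 2))"
    using summable_Suc_iff[of "\<lambda>n. inverse (real n ^ 2)"] inverse_power_summable[of 2, where 'a = real]
    by (intro summable_mult) simp
  then have "summable (\<lambda>n. (b\<^sup>2 / 2 / real (Suc n))\<^sup>2)"
    by (simp only: divide_inverse[of _ "real (Suc _)"] power_mult_distrib power_inverse)
  then have "summable (\<lambda>n. expectation (\<lambda>\<omega>. (h n \<omega> (d (Suc n) \<omega>))\<^sup>2))"
  proof (rule summable_comparison_test'[where N = 0])
    fix n
    have "expectation (\<lambda>\<omega>. (h n \<omega> (d (Suc n) \<omega>))\<^sup>2) \<le> expectation (\<lambda>\<omega>. (b\<^sup>2 / 2 / real (Suc n))\<^sup>2)"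
    proof (rule integral_mono')
      show "(h n \<omega> (d (Suc n) \<omega>))\<^sup>2 \<le> (b\<^sup>2 / 2 / real (Suc n))\<^sup>2" if "\<omega> \<in> space M" for \<omega>
        using power_mono[OF bound[OF that, of n \<omega>], of 2] by simp
    qed auto
    then show "norm (expectation (\<lambda>\<omega>. (h n \<omega> (d (Suc n) \<omega>))\<^sup>2)) \<le> (b\<^sup>2 / 2 / real (Suc n))\<^sup>2"
      by (simp add: prob_space)
  qed
  from AE_summable_centred[OF fresh this] show ?thesis
  proof (rule AE_mp, intro AE_I2 impI)
    fix \<omega> assume "summable (\<lambda>n. h n \<omega> (d (Suc n) \<omega>) - (\<integral>y. h n \<omega> y \<partial>law))"
    moreover have "h n \<omega> (d (Suc n) \<omega>) - (\<integral>y. h n \<omega> y \<partial>law)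
        = (cost (d (Suc n) \<omega>) (L n \<omega>) - f (L n \<omega>)) / real (Suc n)" for n
      by (simp add: h_def exp_cost_def diff_divide_distrib)
    ultimately show "(\<lambda>n. (\<Sum>t<n. cost (d (Suc t) \<omega>) (L t \<omega>) - f (L t \<omega>)) / real n) \<longlonglongrightarrow> 0"
      by (intro Kronecker_tendsto) simp
  qed
qed

text \<open>By \<open>f_descent\<close> the expected cost changes by at most a nonpositive average,
  a centred term and a multiple of \<open>norm (m t)\<close> squared. The last two are summable
  almost surely; subtracting their partial sums leaves a nonincreasing sequence that is bounded
  below.\<close>

lemma AE_convergent_f: "AE \<omega> in M. convergent (\<lambda>t. f (L t \<omega>))"
proof -
  \<comment> \<open>The first-order change of \<open>f\<close> for the unscaled step: at the actual
    next sample the vector \<open>K n \<omega> *v coefs y (L n \<omega>)\<close> is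
    \<open>m n \<omega>\<close>.\<close>
  define h where "h n \<omega> y = - (residual y (L n \<omega>) \<bullet> (correlation (L n \<omega>) *v (K n \<omega> *v coefs y (L n \<omega>))))"
    for n \<omega> y
  define c where "c = b * (b / sqrt l1) * b"
  have c0: "0 \<le> c" using b_nonneg l1_pos by (simp add: c_def)
  have bound: "\<bar>h n \<omega> y\<bar> \<le> c * norm (K n \<omega> *v coefs y (L n \<omega>))" if "norm y \<le> b" for n \<omega> y
  proof -
    let ?k = "K n \<omega> *v coefs y (L n \<omega>)"
    have "\<bar>h n \<omega> y\<bar> \<le> norm (correlation (L n \<omega>)) * norm (outer (residual y (L n \<omega>)) ?k)"
      unfolding h_def inner_outer[symmetric] abs_minus_cancel by (rule Cauchy_Schwarz_ineq2)
    also have "\<dots> \<le> b * (b / sqrt l1) * (b * norm ?k)"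
      unfolding norm_outer using norm_correlation[of "L n \<omega>"] norm_residual_le[of y "L n \<omega>"] that
        b_nonneg l1_pos by (intro mult_mono) auto
    finally show ?thesis by (simp add: c_def mult_ac)
  qed
  have fresh: "fresh_sample M d n (h n) (c * (b / sqrt l1 / l1))" for n
  proof
    have "correlation \<in> borel_measurable (borel :: (real^'r^'p) measure)"
      by (rule borel_measurable_correlation)
    then have [measurable]: "(\<lambda>\<omega>. correlation (L n \<omega>)) \<in> borel_measurable (history n)"
      by (rule measurable_compose[OF L_measurable])
    show "(\<lambda>(\<omega>, y). h n \<omega> y) \<in> borel_measurable (history n \<Otimes>\<^sub>M borel)"
      unfolding h_def by measurable
    fix \<omega> \<omega>' assume \<omega>: "\<omega> \<in> space M" and \<omega>': "\<omega>' \<in> space M"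
    have "norm (K n \<omega> *v coefs (d (Suc n) \<omega>') (L n \<omega>)) \<le> norm (coefs (d (Suc n) \<omega>') (L n \<omega>)) / l1"
      by (rule norm_K_le[OF \<omega>])
    also have "\<dots> \<le> b / sqrt l1 / l1"
      using norm_coefs_le[of "d (Suc n) \<omega>'" "L n \<omega>"] data_bound[OF \<omega>', of n] l1_pos
      by (meson divide_right_mono less_imp_le order_trans real_sqrt_ge_zero)
    finally show "\<bar>h n \<omega> (d (Suc n) \<omega>')\<bar> \<le> c * (b / sqrt l1 / l1)"
      using bound[OF data_bound[OF \<omega>', of n], of n \<omega>] c0 by (meson mult_left_mono order_trans)
  qed
  have h2: "(h n \<omega> (d (Suc n) \<omega>))\<^sup>2 \<le> c\<^sup>2 * (norm (m n \<omega>))\<^sup>2" if "\<omega> \<in> space M" for n \<omega>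
    using power_mono[OF bound[OF data_bound[OF that, of n], of n \<omega>], of 2]
    by (simp add: m_def power_mult_distrib)
  have int: "integrable M (\<lambda>\<omega>. (h n \<omega> (d (Suc n) \<omega>))\<^sup>2)" for n
  proof -
    interpret fresh_sample M d n "h n" "c * (b / sqrt l1 / l1)" by (rule fresh)
    show ?thesis
    proof (rule integrable_bounded)
      show "(\<lambda>\<omega>. (h n \<omega> (d (Suc n) \<omega>))\<^sup>2) \<in> borel_measurable (history (Suc n))"
        using current_measurable by measurable
      show "\<bar>(h n \<omega> (d (Suc n) \<omega>))\<^sup>2\<bar> \<le> (c * (b / sqrt l1 / l1))\<^sup>2" if "\<omega> \<in> space M" for \<omega>
        using power_mono[OF h_bound[OF that that], of 2] by simp
    qed
  qed
  \<comment> \<open>The partial sums are bounded by integrating the trajectorywise bound on the sum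
    of the squares of \<open>norm (m n \<omega>)\<close>.\<close>
  have "summable (\<lambda>n. expectation (\<lambda>\<omega>. (h n \<omega> (d (Suc n) \<omega>))\<^sup>2))"
  proof (rule summableI_nonneg_bounded)
    fix N
    have "(\<Sum>n<N. expectation (\<lambda>\<omega>. (h n \<omega> (d (Suc n) \<omega>))\<^sup>2))
        = expectation (\<lambda>\<omega>. \<Sum>n<N. (h n \<omega> (d (Suc n) \<omega>))\<^sup>2)"
      by (rule Bochner_Integration.integral_sum[symmetric]) (rule int)
    also have "\<dots> \<le> expectation (\<lambda>\<omega>. c\<^sup>2 * ((1 + (b / l1)\<^sup>2) * (CARD('r) / l1)))"
    proof (rule integral_mono')
      fix \<omega> assume \<omega>: "\<omega> \<in> space M"
      have "(\<Sum>n<N. (h n \<omega> (d (Suc n) \<omega>))\<^sup>2) \<le> (\<Sum>n<N. c\<^sup>2 * (norm (m n \<omega>))\<^sup>2)"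
        by (intro sum_mono h2 \<omega>)
      also have "\<dots> \<le> c\<^sup>2 * ((1 + (b / l1)\<^sup>2) * (CARD('r) / l1))"
        unfolding sum_distrib_left[symmetric] by (intro mult_left_mono sum_norm_m_squared \<omega>) simp
      finally show "(\<Sum>n<N. (h n \<omega> (d (Suc n) \<omega>))\<^sup>2) \<le> c\<^sup>2 * ((1 + (b / l1)\<^sup>2) * (CARD('r) / l1))" .
    qed (use l1_pos in \<open>auto intro!: mult_nonneg_nonneg add_nonneg_nonneg\<close>)
    finally show "(\<Sum>n<N. expectation (\<lambda>\<omega>. (h n \<omega> (d (Suc n) \<omega>))\<^sup>2))
        \<le> c\<^sup>2 * ((1 + (b / l1)\<^sup>2) * (CARD('r) / l1))"
      by (simp add: prob_space)
  qed simp
  from AE_summable_centred[OF fresh this] show ?thesis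
  proof (rule AE_mp, intro AE_I2 impI)
    fix \<omega> assume \<omega>: "\<omega> \<in> space M"
    define D where "D n = h n \<omega> (d (Suc n) \<omega>) - (\<integral>y. h n \<omega> y \<partial>law)" for n
    define q where "q n = D n + 2 * b\<^sup>2 * (b / sqrt l1)\<^sup>2 * (norm (m n \<omega>))\<^sup>2" for n
    assume "summable (\<lambda>n. h n \<omega> (d (Suc n) \<omega>) - (\<integral>y. h n \<omega> y \<partial>law))"
    then have "summable q"
      unfolding q_def D_def by (intro summable_add summable_mult summable_norm_m_squared \<omega>)
    then have conv_q: "convergent (\<lambda>n. \<Sum>i<n. q i)" by (simp add: summable_iff_convergent)
    \<comment> \<open>Averaging over the next sample replaces the stochastic gradient by
      \<open>correlation (L n \<omega>)\<close>, and the preconditioner is positive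
      semidefinite.\<close>
    have avg: "(\<integral>y. h n \<omega> y \<partial>law) \<le> 0" for n
    proof -
      have "(\<integral>y. h n \<omega> y \<partial>law) = - (\<integral>y. (correlation (L n \<omega>) ** K n \<omega>) \<bullet> outer (residual y (L n \<omega>)) (coefs y (L n \<omega>)) \<partial>law)"
        by (simp add: h_def inner_outer matrix_vector_mul_assoc)
      also have "\<dots> = - ((correlation (L n \<omega>) ** K n \<omega>) \<bullet> correlation (L n \<omega>))"
        by (simp add: inner_correlation)
      also have "\<dots> \<le> 0"
        using inner_matrix_mult_psd[OF symmetric_psd_K[OF \<omega>]] by (simp add: inner_commute)
      finally show ?thesis .
    qed
    have step: "f (L (Suc t) \<omega>) \<le> f (L t \<omega>) + q t" if "t \<ge> 1" for t
      using f_descent[OF \<omega> that] avg[of t] by (simp add: q_def D_def h_def e_def m_def)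
    \<comment> \<open>The index is shifted because the descent estimate starts at 1; the term
      \<open>q 0\<close> only changes \<open>w\<close> by a constant.\<close>
    define w where "w t = f (L (Suc t) \<omega>) - (\<Sum>i<Suc t. q i)" for t
    have "decseq w"
    proof (rule decseq_SucI)
      show "w (Suc t) \<le> w t" for t
        using step[of "Suc t"] by (simp add: w_def)
    qed
    moreover obtain C where C: "\<And>n. \<bar>\<Sum>i<n. q i\<bar> \<le> C"
      using convergent_imp_Bseq[OF conv_q] by (auto simp: Bseq_def)
    have "- C \<le> w t" for t
      using f_nonneg[of "L (Suc t) \<omega>"] C[of "Suc t"] unfolding w_def by linarith
    ultimately have "convergent w"
      using decseq_convergent[of w "- C"] by (metis convergentI)
    then have "convergent (\<lambda>t. w t + (\<Sum>i<Suc t. q i))"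
      using conv_q convergent_Suc_iff[of "\<lambda>n. \<Sum>i<n. q i"] by (intro convergent_add) simp_all
    then have "convergent (\<lambda>t. f (L (Suc t) \<omega>))" by (simp add: w_def)
    then show "convergent (\<lambda>t. f (L t \<omega>))"
      using convergent_Suc_iff[of "\<lambda>t. f (L t \<omega>)"] by simp
  qed
qed

text \<open>The surrogate value is the average of the increments of \<open>U\<close>. Each increment
  is the expected cost plus a centred cost plus a null sequence, so Cesaro means and the strong law
  give it the same limit \<open>l\<close> as \<open>f (L t \<omega>)\<close>.\<close>

lemma AE_surrogate_minus_f_tendsto_0:
  "AE \<omega> in M. (\<lambda>t. surrogate G l1 l2 (\<lambda>i. d i \<omega>) (\<lambda>i. r i \<omega>) (\<lambda>i. s i \<omega>) t (L t \<omega>) - f (L t \<omega>)) \<longlonglongrightarrow> 0"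
  using AE_cost_average AE_convergent_f AE_space
proof eventually_elim
  case (elim \<omega>)
  note avg = elim(1) and \<omega> = elim(3)
  obtain l where l: "(\<lambda>t. f (L t \<omega>)) \<longlonglongrightarrow> l" using elim(2) by (auto simp: convergent_def)
  let ?g = "\<lambda>t. surrogate G l1 l2 (\<lambda>i. d i \<omega>) (\<lambda>i. r i \<omega>) (\<lambda>i. s i \<omega>) t (L t \<omega>)"
  let ?c = "\<lambda>t. cost (d (Suc t) \<omega>) (L t \<omega>)"
  define U where "U = total_cost \<omega>"
  have "(\<lambda>t. (U (Suc t) - U t - ?c t) + f (L t \<omega>)) \<longlonglongrightarrow> 0 + l"
    unfolding U_def by (intro tendsto_add total_cost_increment \<omega> l)
  from Cesaro_tendsto[OF this]
  have "(\<lambda>n. (\<Sum>t<n. (U (Suc t) - U t - ?c t) + f (L t \<omega>)) / real n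
      + (\<Sum>t<n. ?c t - f (L t \<omega>)) / real n) \<longlonglongrightarrow> (0 + l) + 0"
    by (intro tendsto_add avg)
  also have "(\<lambda>n. (\<Sum>t<n. (U (Suc t) - U t - ?c t) + f (L t \<omega>)) / real n
      + (\<Sum>t<n. ?c t - f (L t \<omega>)) / real n) = (\<lambda>n. (U n - U 0) / real n)"
    by (simp add: add_divide_distrib[symmetric] sum.distrib[symmetric] sum_lessThan_telescope)
  \<comment> \<open>\<open>U 0 = 0\<close> by its factor \<open>real 0\<close>, and at
    \<open>n = 0\<close> both sides vanish because division by zero yields 0.\<close>
  also have "(\<lambda>n. (U n - U 0) / real n) = ?g"
    by (auto simp: fun_eq_iff U_def total_cost_def[OF \<omega>] surrogate_def)
  finally have "?g \<longlonglongrightarrow> l" by simp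
  from tendsto_diff[OF this l] show ?case by simp
qed

end

theorem theorem4:
  fixes M :: "'w measure"
    and G :: "'p::finite set set"
    and l1 l2 Mb :: real
    and d :: "nat \<Rightarrow> 'w \<Rightarrow> real^'p"
    and L0 :: "real^'r::finite^'p"
    and L :: "nat \<Rightarrow> 'w \<Rightarrow> real^'r^'p"
    and r :: "nat \<Rightarrow> 'w \<Rightarrow> real^'r"
    and s :: "nat \<Rightarrow> 'w \<Rightarrow> real^'p"
    and A :: "nat \<Rightarrow> 'w \<Rightarrow> real^'r^'r"
    and B :: "nat \<Rightarrow> 'w \<Rightarrow> real^'r^'p"
  assumes "prob_space M"
    and "l1 > 0" and "l2 > 0"
    and "finite G"
    and rv: "\<And>t. t \<ge> 1 \<Longrightarrow> d t \<in> borel_measurable M"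
    and indep: "prob_space.indep_vars M (\<lambda>_. borel) d {1..}"
    and ident: "\<And>t. t \<ge> 1 \<Longrightarrow> distr M borel (d t) = distr M borel (d 1)"
    and bdd: "\<And>t \<omega>. t \<ge> 1 \<Longrightarrow> \<omega> \<in> space M \<Longrightarrow> norm (d t \<omega>) \<le> Mb"
    and L_0: "\<And>\<omega>. L 0 \<omega> = L0"
    and A_0: "\<And>\<omega>. A 0 \<omega> = 0"
    and B_0: "\<And>\<omega>. B 0 \<omega> = 0"
    and minim: "\<And>t \<omega> r' s'. t \<ge> 1 \<Longrightarrow> \<omega> \<in> space M \<Longrightarrow>
        lhat G l1 l2 (d t \<omega>) (L (t - 1) \<omega>) (r t \<omega>) (s t \<omega>) \<le> lhat G l1 l2 (d t \<omega>) (L (t - 1) \<omega>) r' s'"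
    and A_step: "\<And>t \<omega>. t \<ge> 1 \<Longrightarrow> A t \<omega> = A (t - 1) \<omega> + outer (r t \<omega>) (r t \<omega>)"
    and B_step: "\<And>t \<omega>. t \<ge> 1 \<Longrightarrow> B t \<omega> = B (t - 1) \<omega> + outer (d t \<omega> - s t \<omega>) (r t \<omega>)"
    and L_step: "\<And>t \<omega>. t \<ge> 1 \<Longrightarrow> L t \<omega> = B t \<omega> ** matrix_inv (A t \<omega> + l1 *\<^sub>R mat 1)"
  shows "AE \<omega> in M. (\<lambda>t. surrogate G l1 l2 (\<lambda>i. d i \<omega>) (\<lambda>i. r i \<omega>) (\<lambda>i. s i \<omega>) t (L t \<omega>)
                        - exp_cost G l1 l2 (distr M borel (d 1)) (L t \<omega>)) \<longlonglongrightarrow> 0"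
proof -
  interpret lsd G l1 l2 using \<open>l1 > 0\<close> \<open>l2 > 0\<close> by unfold_locales
  interpret prob_space M by fact
  interpret iid_sequence M d by unfold_locales (fact rv indep ident)+
  interpret olsd G l1 l2 M d L0 L r s A B Mb
  proof (rule olsd.intro[OF lsd_axioms iid_sequence_axioms], rule olsd_axioms.intro)
    show "L 0 \<omega> = L0" for \<omega> by (rule L_0)
    show "lsd_path G l1 l2 (\<lambda>t. d t \<omega>) (\<lambda>t. L t \<omega>) (\<lambda>t. r t \<omega>) (\<lambda>t. s t \<omega>) (\<lambda>t. A t \<omega>) (\<lambda>t. B t \<omega>) Mb"
      if "\<omega> \<in> space M" for \<omega>
    proof
      show "optimal (d (Suc t) \<omega>) (L t \<omega>) (r (Suc t) \<omega>) (s (Suc t) \<omega>)" for t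
        using minim[OF _ that, of "Suc t"] by (simp add: optimal_def)
      show "A (Suc t) \<omega> = A t \<omega> + outer (r (Suc t) \<omega>) (r (Suc t) \<omega>)" for t
        using A_step[of "Suc t"] by simp
      show "B (Suc t) \<omega> = B t \<omega> + outer (d (Suc t) \<omega> - s (Suc t) \<omega>) (r (Suc t) \<omega>)" for t
        using B_step[of "Suc t"] by simp
      show "L (Suc t) \<omega> = B (Suc t) \<omega> ** matrix_inv (A (Suc t) \<omega> + l1 *\<^sub>R mat 1)" for t
        by (rule L_step) simp
    qed (use bdd that A_0 B_0 in auto)
  qed
  show ?thesis
    using AE_surrogate_minus_f_tendsto_0 by (simp only: law_def)
qed

end
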